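(* Let $M$ be a smooth compact manifold without boundary, of dimension $d\ge 1$. Fix $t>0$. Let $g_1,g_2$ be $C^2$ Riemannian metrics on $M$, and let $p_1,p_2\in C(M)$ satisfy $p_1>0$ and $p_2>0$ on $M$. For $i=1,2$ define the operator $L^{(g_i)}_{t,p_i}$ on $C(M)$ by $$(L^{(g_i)}_{t,p_i} f)(x):=\frac{1}{t^{\frac d2+1}}\int_M \exp\Big(-\frac{d_{g_i}(x,y)^2}{t}\Big)\,\bigl(f(x)-f(y)\bigr)\,p_i(y)\,d\mu_{g_i}(y),\qquad f\in C(M),\ x\in M.$$ If $L^{(g_1)}_{t,p_1}=L^{(g_2)}_{t,p_2}$ as operators on $C(M)$, then $g_1=g_2$ and $p_1=p_2$.
   Context: $C(M)$ denotes the space of continuous real-valued functions on $M$. For a Riemannian metric $g$ on $M$, $d_g$ denotes the geodesic (intrinsic) distance induced by $g$, i.e. the infimum of $g$-lengths of piecewise $C^1$ curves joining two points (if $M$ is disconnected, $d_g(x,y)=+\infty$ for points in different components and $\exp(-\infty)=0$), and $\mu_g$ denotes the Riemannian volume measure of $g$. *)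

theory Defs
  imports "HOL-Analysis.Analysis"
begin

section \<open>Maps of class \<open>C\<^sup>k\<close> on open sets\<close>

text \<open>Only meaningful for open \<open>S\<close>: the derivatives are unrestricted ones.\<close>

fun C_k_on :: "nat \<Rightarrow> 'a::real_normed_vector set \<Rightarrow> ('a \<Rightarrow> 'b::real_normed_vector) \<Rightarrow> bool" where
  "C_k_on 0 S f \<longleftrightarrow> continuous_on S f"
| "C_k_on (Suc k) S f \<longleftrightarrow>
     (\<forall>x\<in>S. f differentiable (at x)) \<and> (\<forall>v. C_k_on k S (\<lambda>x. frechet_derivative f (at x) v))"

definition C_infinity_on ::
  "'a::real_normed_vector set \<Rightarrow> ('a \<Rightarrow> 'b::real_normed_vector) \<Rightarrow> bool" where
  "C_infinity_on S f \<longleftrightarrow> (\<forall>k. C_k_on k S f)"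


section \<open>Smooth manifolds without boundary\<close>

text \<open>
  The underlying space of the manifold is a whole type \<open>'a\<close>, and its dimension is \<open>CARD('n)\<close>,
  which is at least 1. A chart is given by its domain and its coordinate map; the values
  of the coordinate map outside the domain are irrelevant. A smooth structure is presented by
  an atlas, which need not be maximal.
\<close>

type_synonym ('a, 'n) chart = "'a set \<times> ('a \<Rightarrow> real ^ 'n)"

abbreviation chart_dom :: "('a, 'n) chart \<Rightarrow> 'a set" where
  "chart_dom \<equiv> fst"

abbreviation chart_map :: "('a, 'n) chart \<Rightarrow> 'a \<Rightarrow> real ^ 'n" where
  "chart_map \<equiv> snd"

abbreviation chart_image :: "('a, 'n) chart \<Rightarrow> (real ^ 'n) set" where
  "chart_image c \<equiv> chart_map c ` chart_dom c"

definition chart_inv :: "('a, 'n) chart \<Rightarrow> real ^ 'n \<Rightarrow> 'a" where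
  "chart_inv c = inv_into (chart_dom c) (chart_map c)"

definition is_chart :: "('a::topological_space, 'n::finite) chart \<Rightarrow> bool" where
  "is_chart c \<longleftrightarrow> open (chart_dom c) \<and> open (chart_image c) \<and>
     homeomorphism (chart_dom c) (chart_image c) (chart_map c) (chart_inv c)"

definition transition ::
  "('a, 'n) chart \<Rightarrow> ('a, 'n) chart \<Rightarrow> real ^ 'n \<Rightarrow> real ^ 'n" where
  "transition c c' = chart_map c' \<circ> chart_inv c"

definition smooth_atlas :: "('a::topological_space, 'n::finite) chart set \<Rightarrow> bool" where
  "smooth_atlas A \<longleftrightarrow> (\<forall>c\<in>A. is_chart c) \<and> (\<Union>c\<in>A. chart_dom c) = UNIV \<and>
     (\<forall>c\<in>A. \<forall>c'\<in>A. C_infinity_on (chart_map c ` (chart_dom c \<inter> chart_dom c')) (transition c c'))"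


section \<open>Tangent vectors\<close>

text \<open>
  A tangent vector at \<open>x\<close> is the family of its coordinate representations, one for each chart
  of the atlas around \<open>x\<close>, related by the derivatives of the transition maps. The vector space
  operations are pointwise. Setting the family to 0 at all other charts makes equality of
  functions the right equality of tangent vectors.
\<close>

type_synonym ('a, 'n) tangent_vector = "('a, 'n) chart \<Rightarrow> real ^ 'n"

definition charts_at :: "('a, 'n) chart set \<Rightarrow> 'a \<Rightarrow> ('a, 'n) chart set" where
  "charts_at A x = {c \<in> A. x \<in> chart_dom c}"

definition tangent_space ::
  "('a, 'n::finite) chart set \<Rightarrow> 'a \<Rightarrow> ('a, 'n) tangent_vector set" where
  "tangent_space A x = {v.
     (\<forall>c. c \<notin> charts_at A x \<longrightarrow> v c = 0) \<and>
     (\<forall>c\<in>charts_at A x. \<forall>c'\<in>charts_at A x.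
        v c' = frechet_derivative (transition c c') (at (chart_map c x)) (v c))}"

text \<open>The tangent vector at \<open>x\<close> whose coordinates in the chart \<open>c\<close> are \<open>w\<close>.\<close>

definition tangent_of_coords ::
  "('a, 'n::finite) chart set \<Rightarrow> ('a, 'n) chart \<Rightarrow> 'a \<Rightarrow> real ^ 'n \<Rightarrow> ('a, 'n) tangent_vector" where
  "tangent_of_coords A c x w = (\<lambda>c'. if c' \<in> charts_at A x
     then frechet_derivative (transition c c') (at (chart_map c x)) w else 0)"


section \<open>Riemannian metrics\<close>

type_synonym ('a, 'n) metric_field =
  "'a \<Rightarrow> ('a, 'n) tangent_vector \<Rightarrow> ('a, 'n) tangent_vector \<Rightarrow> real"

definition inner_product_on ::
  "('i \<Rightarrow> 'v::real_vector) set \<Rightarrow> (('i \<Rightarrow> 'v) \<Rightarrow> ('i \<Rightarrow> 'v) \<Rightarrow> real) \<Rightarrow> bool" where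
  "inner_product_on V ip \<longleftrightarrow>
     (\<forall>u\<in>V. \<forall>v\<in>V. ip u v = ip v u) \<and>
     (\<forall>u\<in>V. \<forall>u'\<in>V. \<forall>v\<in>V. \<forall>a b.
        ip (\<lambda>c. a *\<^sub>R u c + b *\<^sub>R u' c) v = a * ip u v + b * ip u' v) \<and>
     (\<forall>v\<in>V. v \<noteq> (\<lambda>_. 0) \<longrightarrow> ip v v > 0)"

text \<open>The Gram matrix \<open>g\<^sub>i\<^sub>j\<close> at \<open>x\<close> in the chart \<open>c\<close>.\<close>

definition metric_matrix ::
  "('a, 'n::finite) chart set \<Rightarrow> ('a, 'n) metric_field \<Rightarrow> ('a, 'n) chart \<Rightarrow> 'a \<Rightarrow> real ^ 'n ^ 'n" where
  "metric_matrix A g c x =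
     (\<chi> i j. g x (tangent_of_coords A c x (axis i 1)) (tangent_of_coords A c x (axis j 1)))"

definition riemannian_metric ::
  "nat \<Rightarrow> ('a, 'n::finite) chart set \<Rightarrow> ('a, 'n) metric_field \<Rightarrow> bool" where
  "riemannian_metric k A g \<longleftrightarrow>
     (\<forall>x. inner_product_on (tangent_space A x) (g x)) \<and>
     (\<forall>c\<in>A. C_k_on k (chart_image c) (\<lambda>z. metric_matrix A g c (chart_inv c z)))"

text \<open>
  A metric is a function on all families of coordinate vectors, but only its values on tangent
  vectors carry meaning, so equality of metrics is equality on the tangent spaces.
\<close>

definition metric_eq ::
  "('a, 'n::finite) chart set \<Rightarrow> ('a, 'n) metric_field \<Rightarrow> ('a, 'n) metric_field \<Rightarrow> bool" where
  "metric_eq A g h \<longleftrightarrow>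
     (\<forall>x. \<forall>u\<in>tangent_space A x. \<forall>v\<in>tangent_space A x. g x u v = h x u v)"


section \<open>Geodesic distance\<close>

text \<open>Continuously differentiable on the closed interval, with one-sided derivatives at the ends.\<close>

definition C1_curve_on ::
  "('a::topological_space, 'n::finite) chart set \<Rightarrow> (real \<Rightarrow> 'a) \<Rightarrow> real \<Rightarrow> real \<Rightarrow> bool" where
  "C1_curve_on A \<gamma> a b \<longleftrightarrow> continuous_on {a..b} \<gamma> \<and>
     (\<forall>c\<in>A. \<exists>D. continuous_on {s\<in>{a..b}. \<gamma> s \<in> chart_dom c} D \<and>
        (\<forall>s\<in>{a..b}. \<gamma> s \<in> chart_dom c \<longrightarrow>
           ((chart_map c \<circ> \<gamma>) has_vector_derivative D s) (at s within {a..b})))"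

text \<open>
  This is stronger than the corresponding library predicate for vector-valued curves, which
  allows the derivative to be unbounded near the break points.
\<close>

definition piecewise_C1_curve ::
  "('a::topological_space, 'n::finite) chart set \<Rightarrow> (real \<Rightarrow> 'a) \<Rightarrow> bool" where
  "piecewise_C1_curve A \<gamma> \<longleftrightarrow>
     (\<exists>n \<tau>. \<tau> 0 = 0 \<and> \<tau> n = 1 \<and>
        (\<forall>i<n. \<tau> i < \<tau> (Suc i) \<and> C1_curve_on A \<gamma> (\<tau> i) (\<tau> (Suc i))))"

definition velocity ::
  "('a, 'n::finite) chart set \<Rightarrow> (real \<Rightarrow> 'a) \<Rightarrow> real \<Rightarrow> ('a, 'n) tangent_vector" where
  "velocity A \<gamma> s = (\<lambda>c. if c \<in> charts_at A (\<gamma> s)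
     then vector_derivative (chart_map c \<circ> \<gamma>) (at s within {0..1}) else 0)"

text \<open>At the finitely many break points the velocity is arbitrary; the integral ignores them.\<close>

definition curve_length ::
  "('a, 'n::finite) chart set \<Rightarrow> ('a, 'n) metric_field \<Rightarrow> (real \<Rightarrow> 'a) \<Rightarrow> real" where
  "curve_length A g \<gamma> = integral {0..1} (\<lambda>s. sqrt (g (\<gamma> s) (velocity A \<gamma> s) (velocity A \<gamma> s)))"

text \<open>The infimum of the empty set is \<open>\<infinity>\<close>, the distance between different components.\<close>

definition geodesic_dist ::
  "('a::topological_space, 'n::finite) chart set \<Rightarrow> ('a, 'n) metric_field \<Rightarrow> 'a \<Rightarrow> 'a \<Rightarrow> ennreal" where
  "geodesic_dist A g x y =
     (INF \<gamma>\<in>{\<gamma>. piecewise_C1_curve A \<gamma> \<and> \<gamma> 0 = x \<and> \<gamma> 1 = y}. ennreal (curve_length A g \<gamma>))"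


section \<open>Riemannian volume measure\<close>

text \<open>The Borel measure given by \<open>sqrt (det g) dz\<close> in every chart.\<close>

definition is_riemannian_volume ::
  "('a::topological_space, 'n::finite) chart set \<Rightarrow> ('a, 'n) metric_field \<Rightarrow> 'a measure \<Rightarrow> bool" where
  "is_riemannian_volume A g \<mu> \<longleftrightarrow> sets \<mu> = sets borel \<and>
     (\<forall>c\<in>A. \<forall>B\<in>sets borel. B \<subseteq> chart_dom c \<longrightarrow>
        emeasure \<mu> B =
          (\<integral>\<^sup>+z\<in>chart_map c ` B. ennreal (sqrt (det (metric_matrix A g c (chart_inv c z)))) \<partial>lborel))"

definition riemannian_volume ::
  "('a::topological_space, 'n::finite) chart set \<Rightarrow> ('a, 'n) metric_field \<Rightarrow> 'a measure" where
  "riemannian_volume A g = (THE \<mu>. is_riemannian_volume A g \<mu>)"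


section \<open>The operator \<open>L\<close>\<close>

text \<open>\<open>exp (- r\<^sup>2 / t)\<close> with the convention \<open>exp (- \<infinity>) = 0\<close>.\<close>

definition gauss_kernel :: "real \<Rightarrow> ennreal \<Rightarrow> real" where
  "gauss_kernel t r = (if r = \<infinity> then 0 else exp (- (enn2real r)\<^sup>2 / t))"

definition L_op ::
  "('a::topological_space, 'n::finite) chart set \<Rightarrow> real \<Rightarrow> ('a, 'n) metric_field \<Rightarrow> ('a \<Rightarrow> real) \<Rightarrow>
     ('a \<Rightarrow> real) \<Rightarrow> 'a \<Rightarrow> real" where
  "L_op A t g p f x = 1 / t powr (real CARD('n) / 2 + 1) *
     (LINT y|riemannian_volume A g. gauss_kernel t (geodesic_dist A g x y) * (f x - f y) * p y)"

end

theory Submission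
  imports Defs
begin

text \<open>
  Fix a point \<open>x\<close> and a chart around it. If a continuous function \<open>f\<close> vanishes at \<open>x\<close>, then
  \<open>(L f)(x)\<close> is, up to a nonzero factor depending only on \<open>t\<close> and the dimension, the integral of \<open>f\<close> against
  \<open>k(x,y) p(y) d\<mu>(y)\<close>, where \<open>k(x,y) = exp (- d(x,y)\<^sup>2 / t)\<close>. Letting \<open>f\<close> run through bump functions
  supported in the chart and away from \<open>x\<close>, equality of the operators gives equality of the
  densities of these measures with respect to Lebesgue measure in the chart,
  \<open>k\<^sub>1(x,y) p\<^sub>1(y) sqrt (det g\<^sub>1(y)) = k\<^sub>2(x,y) p\<^sub>2(y) sqrt (det g\<^sub>2(y))\<close>,
  for \<open>y \<noteq> x\<close> near \<open>x\<close>, because both sides are continuous in \<open>y\<close>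
  (\<open>bump_integrals_determine\<close>, \<open>kernel_densities_eq\<close>).

  Now let \<open>y\<close> tend to \<open>x\<close>. Both kernels tend to 1, so \<open>p\<^sub>1 sqrt (det g\<^sub>1) = p\<^sub>2 sqrt (det g\<^sub>2)\<close> at
  \<open>x\<close>, hence at every point (\<open>weighted_volumes_eq\<close>). Dividing this out leaves \<open>k\<^sub>1 = k\<^sub>2\<close> near the
  diagonal, and as \<open>t\<close> is fixed, \<open>d\<^sub>1 = d\<^sub>2\<close> there (\<open>geodesic_dist_eq\<close>). A geodesic distance
  determines its metric: in coordinates \<open>d(x, x + s w) / s\<close> tends to the length of \<open>w\<close> in the metric
  at \<open>x\<close> as \<open>s\<close> tends to 0 (\<open>geodesic_dist_local\<close>), and a scalar product is determined by its
  lengths (\<open>symmetric_form_eq\<close>). So \<open>g\<^sub>1 = g\<^sub>2\<close>, and then \<open>p\<^sub>1 = p\<^sub>2\<close> by cancelling the determinants.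

  Two bodies of theory support this. On the side of the distance: the speed of a piecewise \<open>C\<^sup>1\<close>
  curve is integrable and lengths add up under concatenation, which gives the triangle inequality
  and with it the continuity of the kernel; straight segments in a chart bound the distance from
  above, and a first exit argument bounds it from below. On the side of the volume: the change of
  variables formula makes the coordinate volumes of different charts agree, so that they glue to a
  unique Borel measure on a compact manifold, and integrals of functions supported in a chart can be
  computed in coordinates (\<open>integral_riemannian_volume\<close>).
\<close>

section \<open>Change of variables in Lebesgue integrals over \<open>\<real>\<^sup>n\<close>\<close>

lemma nn_integral_eq_integral_or_top:
  fixes f :: "'a::euclidean_space \<Rightarrow> real"
  assumes meas: "(\<lambda>x. indicator S x * f x) \<in> borel_measurable borel"
    and nonneg: "\<And>x. x \<in> S \<Longrightarrow> 0 \<le> f x"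
  shows "(\<integral>\<^sup>+x\<in>S. ennreal (f x) \<partial>lborel) =
    (if f integrable_on S then ennreal (integral S f) else \<infinity>)"
proof -
  let ?h = "\<lambda>x. indicator S x * f x"
  have eq: "(\<integral>\<^sup>+x\<in>S. ennreal (f x) \<partial>lborel) = (\<integral>\<^sup>+x. ennreal (?h x) \<partial>lborel)"
    by (rule nn_integral_cong) (auto simp: indicator_def)
  have int: "f integrable_on S \<longleftrightarrow> ?h integrable_on UNIV"
  proof -
    have "?h = (\<lambda>x. if x \<in> S then f x else 0)" by (auto simp: indicator_def)
    then show ?thesis by (simp only: integrable_restrict_UNIV)
  qed
  have h0: "0 \<le> ?h x" for x
    using nonneg by (cases "x \<in> S") auto
  show ?thesis
  proof (cases "f integrable_on S")
    case True
    then have "(f has_integral integral S f) S" by (rule integrable_integral)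
    then show ?thesis
      using nn_integral_has_integral_lebesgue[OF nonneg, where I = "integral S f"] True eq by simp
  next
    case False
    then have "\<not> (\<integral>\<^sup>+x. ennreal (?h x) \<partial>lborel) < \<infinity>"
      using nn_integral_integrable_on[OF meas h0] int by blast
    then have "(\<integral>\<^sup>+x. ennreal (?h x) \<partial>lborel) = \<infinity>"
      unfolding less_top[symmetric] infinity_ennreal_def by simp
    then show ?thesis using False eq by simp
  qed
qed

text \<open>
  For nonnegative functions the equivalence of absolute integrability on both sides also covers
  the case of an infinite integral. The coordinates are ordered here, as in
  \<open>has_absolute_integral_change_of_variables\<close>, from which the formula is derived.
\<close>

lemma nn_integral_change_of_variables_wellorder:
  fixes T :: "real ^ 'm::{finite,wellorder} \<Rightarrow> real ^ 'm::_" and f h :: "real ^ 'm::_ \<Rightarrow> real"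
  assumes S: "S \<in> sets borel"
    and der: "\<And>x. x \<in> S \<Longrightarrow> (T has_derivative T' x) (at x)"
    and inj: "inj_on T S"
    and meas_f: "(\<lambda>y. indicator (T ` S) y * f y) \<in> borel_measurable borel"
    and meas_h: "(\<lambda>x. indicator S x * h x) \<in> borel_measurable borel"
    and nonneg: "\<And>y. y \<in> T ` S \<Longrightarrow> 0 \<le> f y"
    and h: "\<And>x. x \<in> S \<Longrightarrow> h x = \<bar>det (matrix (T' x))\<bar> * f (T x)"
  shows "(\<integral>\<^sup>+y\<in>T ` S. ennreal (f y) \<partial>lborel) = (\<integral>\<^sup>+x\<in>S. ennreal (h x) \<partial>lborel)"
proof -
  let ?f = "\<lambda>y. vec (f y) :: real^1"
  let ?j = "\<lambda>x. \<bar>det (matrix (T' x))\<bar> * f (T x)"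
  have S': "S \<in> sets lebesgue" using S by simp
  have der': "(T has_derivative T' x) (at x within S)" if "x \<in> S" for x
    using der[OF that] by (rule has_derivative_at_withinI)
  have j: "(\<lambda>x. \<bar>det (matrix (T' x))\<bar> *\<^sub>R ?f (T x)) = (\<lambda>x. vec (?j x))"
    by (auto simp: vec_eq_iff)
  have nonneg_h: "0 \<le> h x" if "x \<in> S" for x
    using h nonneg that by auto
  have iff: "?j absolutely_integrable_on S \<and> integral S ?j = b \<longleftrightarrow>
      f absolutely_integrable_on (T ` S) \<and> integral (T ` S) f = b" for b
    using has_absolute_integral_change_of_variables[OF S' der' inj, of ?f "vec b"]
    unfolding j absolutely_integrable_on_1_iff integral_on_1_eq
    by (auto simp: o_def vec_eq_iff)
  have hj: "h integrable_on S \<longleftrightarrow> ?j integrable_on S" "integral S h = integral S ?j"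
    using h by (auto intro!: integrable_cong integral_cong)
  have ai: "f absolutely_integrable_on (T ` S) \<longleftrightarrow> f integrable_on (T ` S)"
    "?j absolutely_integrable_on S \<longleftrightarrow> ?j integrable_on S"
    using nonneg by (auto intro!: absolutely_integrable_on_iff_nonneg)
  have int: "f integrable_on T ` S \<longleftrightarrow> h integrable_on S"
  proof
    show "h integrable_on S" if "f integrable_on T ` S"
      using iff[of "integral (T ` S) f"] that unfolding hj(1) ai by simp
    show "f integrable_on T ` S" if "h integrable_on S"
      using iff[of "integral S ?j"] that unfolding hj(1) ai by simp
  qed
  have eq: "integral (T ` S) f = integral S h" if "h integrable_on S"
    using iff[of "integral S ?j"] that unfolding hj ai by simp
  show ?thesis
    using nn_integral_eq_integral_or_top[OF meas_f nonneg]
      nn_integral_eq_integral_or_top[OF meas_h nonneg_h]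
    by (simp only: int eq cong: if_cong)
qed

text \<open>
  A copy of a finite type carrying some linear order. Coordinates can be renamed along it to
  transport results from well-ordered to arbitrary finite index types.
\<close>

typedef ('n::finite) wo_copy = "UNIV :: 'n set" ..

instance wo_copy :: (finite) finite
proof
  show "finite (UNIV :: 'a wo_copy set)"
    unfolding type_definition.univ[OF type_definition_wo_copy] by simp
qed

definition wo_copy_rank :: "'n::finite wo_copy \<Rightarrow> nat" where
  "wo_copy_rank = (SOME f. inj f)"

lemma inj_wo_copy_rank: "inj (wo_copy_rank :: 'n::finite wo_copy \<Rightarrow> nat)"
proof -
  have "\<exists>f :: 'n wo_copy \<Rightarrow> nat. inj f"
    using finite_imp_inj_to_nat_seg[OF finite[of "UNIV :: 'n wo_copy set"]] by metis
  then show ?thesis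
    unfolding wo_copy_rank_def by (rule someI_ex)
qed

instantiation wo_copy :: (finite) linorder
begin
definition "x \<le> y \<longleftrightarrow> wo_copy_rank x \<le> wo_copy_rank (y :: 'a wo_copy)"
definition "x < y \<longleftrightarrow> wo_copy_rank x < wo_copy_rank (y :: 'a wo_copy)"
instance
  by intro_classes (auto simp: less_eq_wo_copy_def less_wo_copy_def dest: injD[OF inj_wo_copy_rank])
end

instance wo_copy :: (finite) wellorder
proof
  fix P :: "'a wo_copy \<Rightarrow> bool" and a
  assume step: "\<And>x. (\<And>y. y < x \<Longrightarrow> P y) \<Longrightarrow> P x"
  show "P a"
  proof (induction "wo_copy_rank a" arbitrary: a rule: less_induct)
    case less
    show ?case
      by (rule step, rule less, simp only: less_wo_copy_def)
  qed
qed

text \<open>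
  Conjugation with \<open>r\<close> is a sign preserving bijection between the permutations of the two index types.
\<close>

lemma det_reindex:
  fixes B :: "real ^ 'n::finite ^ 'n" and r :: "'m::finite \<Rightarrow> 'n"
  assumes r: "bij r"
  shows "det (\<chi> i j. B $ r i $ r j) = det B"
proof -
  let ?r = "inv r"
  have inj: "inj r" and surj: "surj r" using r by (auto simp: bij_def)
  let ?m = "map_permutation UNIV r"
  have app: "?m p (r i) = r (p i)" for p i
    using map_permutation_apply[OF inj] by simp
  have "det (\<chi> i j. B $ r i $ r j) =
    (\<Sum>p | p permutes UNIV. of_int (sign p) * (\<Prod>i\<in>UNIV. B $ r i $ r (p i)))"
    by (simp add: det_def)
  also have "\<dots> = (\<Sum>p | p permutes (UNIV::'m set). of_int (sign (?m p)) * (\<Prod>i\<in>UNIV. B $ i $ ?m p i))"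
  proof (rule sum.cong[OF refl])
    fix p :: "'m \<Rightarrow> 'm" assume "p \<in> {p. p permutes UNIV}"
    then have "sign (?m p) = sign p" by (simp add: sign_map_permutation inj)
    moreover have "(\<Prod>i\<in>UNIV. B $ r i $ r (p i)) = (\<Prod>i\<in>UNIV. B $ r i $ ?m p (r i))"
      by (simp add: app)
    moreover have "\<dots> = (\<Prod>i\<in>UNIV. B $ i $ ?m p i)"
      by (rule prod.reindex_bij_betw[OF r])
    ultimately show "of_int (sign p) * (\<Prod>i\<in>UNIV. B $ r i $ r (p i)) =
      of_int (sign (?m p)) * (\<Prod>i\<in>UNIV. B $ i $ ?m p i)" by simp
  qed
  also have "\<dots> = (\<Sum>q | q permutes (UNIV::'n set). of_int (sign q) * (\<Prod>i\<in>UNIV. B $ i $ q i))"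
  proof (rule sum.reindex_bij_witness[of _ "map_permutation UNIV ?r" ?m])
    fix p :: "'m \<Rightarrow> 'm" assume p: "p \<in> {p. p permutes UNIV}"
    then show "map_permutation UNIV ?r (?m p) = p"
      using r inj by (intro map_permutation_compose_inv) auto
    show "?m p \<in> {p. p permutes UNIV}"
      using p r by (auto intro: map_permutation_permutes)
  next
    fix p :: "'n \<Rightarrow> 'n" assume p: "p \<in> {p. p permutes UNIV}"
    then show "?m (map_permutation UNIV ?r p) = p"
      using r bij_imp_bij_inv[OF r] surj by (intro map_permutation_compose_inv) (auto simp: surj_f_inv_f)
    show "map_permutation UNIV ?r p \<in> {p. p permutes UNIV}"
      using p bij_imp_bij_inv[OF r] by (auto intro: map_permutation_permutes)
  qed auto
  finally show ?thesis by (simp add: det_def)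
qed

definition reindex :: "('m \<Rightarrow> 'n) \<Rightarrow> real ^ 'n \<Rightarrow> real ^ 'm" where
  "reindex r x = (\<chi> i. x $ r i)"

lemma bounded_linear_reindex: "bounded_linear (reindex r :: real ^ 'n::finite \<Rightarrow> real ^ 'm::finite)"
  unfolding reindex_def by (intro linear_conv_bounded_linear[THEN iffD1] linearI) (auto simp: vec_eq_iff)

lemma reindex_measurable [measurable]:
  "(reindex r :: real ^ 'n::finite \<Rightarrow> real ^ 'm::finite) \<in> borel_measurable borel"
  by (intro borel_measurable_continuous_onI linear_continuous_on bounded_linear_reindex)

lemma reindex_inv:
  assumes "bij r"
  shows "reindex (inv r) (reindex r x) = x" "reindex r (reindex (inv r) y) = y"
  using assms by (auto simp: reindex_def vec_eq_iff bij_def surj_f_inv_f inv_f_f)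

lemma lborel_reindex:
  fixes r :: "'m::finite \<Rightarrow> 'n::finite"
  assumes r: "bij r"
  shows "distr lborel borel (reindex r) = (lborel :: (real ^ 'm) measure)"
proof (rule lborel_eqI[symmetric])
  have ri: "bij (inv r)" using r by (rule bij_imp_bij_inv)
  fix l u :: "real ^ 'm" assume lu: "\<And>b. b \<in> Basis \<Longrightarrow> l \<bullet> b \<le> u \<bullet> b"
  let ?q = "reindex (inv r) :: real ^ 'm \<Rightarrow> real ^ 'n"
  have pre: "reindex r -` box l u = box (?q l) (?q u)"
  proof -
    have "(\<forall>i. l $ i < x $ r i \<and> x $ r i < u $ i) \<longleftrightarrow>
        (\<forall>k. l $ inv r k < x $ k \<and> x $ k < u $ inv r k)" for x :: "real ^ 'n"
    proof safe
      fix k assume "\<forall>i. l $ i < x $ r i \<and> x $ r i < u $ i"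
      then have "l $ inv r k < x $ r (inv r k) \<and> x $ r (inv r k) < u $ inv r k" by blast
      then show "l $ inv r k < x $ k" "x $ k < u $ inv r k"
        using r by (simp_all add: bij_is_surj surj_f_inv_f)
    next
      fix i assume "\<forall>k. l $ inv r k < x $ k \<and> x $ k < u $ inv r k"
      then have "l $ inv r (r i) < x $ r i \<and> x $ r i < u $ inv r (r i)" by blast
      then show "l $ i < x $ r i" "x $ r i < u $ i"
        using r by (simp_all add: bij_is_inj inv_f_f)
    qed
    then show ?thesis by (auto simp: mem_box_cart reindex_def)
  qed
  have le: "l $ i \<le> u $ i" for i
    using lu[of "axis i 1"] by (simp add: inner_axis axis_in_Basis_iff)
  have prods: "(\<Prod>b\<in>Basis. v \<bullet> b) = (\<Prod>i\<in>UNIV. v $ i)" for v :: "real ^ 'k::finite"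
    by (simp add: Basis_vec_def prod.reindex inner_axis cart_eq_inner_axis[symmetric]
        UNION_singleton_eq_range prod.UNION_disjoint inj_on_def axis_eq_axis)
  have "emeasure (distr lborel borel (reindex r)) (box l u) = emeasure lborel (box (?q l) (?q u))"
    by (simp add: emeasure_distr pre)
  also have "\<dots> = (\<Prod>b\<in>Basis. (?q u - ?q l) \<bullet> b)"
  proof (rule emeasure_lborel_box)
    fix b :: "real ^ 'n" assume "b \<in> Basis"
    then obtain k where "b = axis k 1" by (auto simp: Basis_vec_def)
    then show "?q l \<bullet> b \<le> ?q u \<bullet> b" by (simp add: inner_axis reindex_def le)
  qed
  also have "(\<Prod>b\<in>Basis. (?q u - ?q l) \<bullet> b) = (\<Prod>k\<in>UNIV. (u - l) $ inv r k)"
    unfolding prods by (simp add: reindex_def)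
  also have "\<dots> = (\<Prod>i\<in>UNIV. (u - l) $ i)"
    by (rule prod.reindex_bij_betw[OF ri])
  finally show "emeasure (distr lborel borel (reindex r)) (box l u) = (\<Prod>b\<in>Basis. (u - l) \<bullet> b)"
    unfolding prods by simp
qed simp


text \<open>
  Renaming coordinates changes neither Lebesgue measure nor determinants, so the formula passes from
  the ordered copy of the index type to the index type itself. Giving the pulled back integrand a name \<open>h\<close>
  allows its measurability to be established from another formula for it.
\<close>

lemma nn_integral_change_of_variables:
  fixes T :: "real ^ 'n::finite \<Rightarrow> real ^ 'n" and f h :: "real ^ 'n \<Rightarrow> real"
  assumes S: "S \<in> sets borel"
    and der: "\<And>x. x \<in> S \<Longrightarrow> (T has_derivative T' x) (at x)"
    and inj: "inj_on T S"
    and meas_f: "(\<lambda>y. indicator (T ` S) y * f y) \<in> borel_measurable borel"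
    and meas_h: "(\<lambda>x. indicator S x * h x) \<in> borel_measurable borel"
    and nonneg: "\<And>y. y \<in> T ` S \<Longrightarrow> 0 \<le> f y"
    and h: "\<And>x. x \<in> S \<Longrightarrow> h x = \<bar>det (matrix (T' x))\<bar> * f (T x)"
  shows "(\<integral>\<^sup>+y\<in>T ` S. ennreal (f y) \<partial>lborel) = (\<integral>\<^sup>+x\<in>S. ennreal (h x) \<partial>lborel)"
proof -
  let ?r = "Rep_wo_copy :: 'n wo_copy \<Rightarrow> 'n"
  have r: "bij ?r"
    by (rule bijI, rule injI, simp add: Rep_wo_copy_inject, rule surjI[where f = Abs_wo_copy])
      (simp add: Abs_wo_copy_inverse)
  let ?P = "reindex ?r :: real ^ 'n \<Rightarrow> real ^ 'n wo_copy"
  let ?Q = "reindex (inv ?r) :: real ^ 'n wo_copy \<Rightarrow> real ^ 'n"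
  note PQ [simp] = reindex_inv[OF r]
  let ?T = "?P \<circ> T \<circ> ?Q" and ?T' = "\<lambda>x. ?P \<circ> T' (?Q x) \<circ> ?Q"
  have PS: "?P ` X = ?Q -` X" for X :: "(real^'n) set"
    by (auto intro!: image_eqI[where x = "?Q x" for x])
  have TPS: "?T ` (?P ` S) = ?P ` (T ` S)"
    by (auto simp: image_iff)
  have ind: "indicator (?P ` X) y = (indicator X (?Q y) :: real)" for X y
    unfolding PS by (auto simp: indicator_def)
  have transfer: "(\<integral>\<^sup>+y\<in>X. ennreal (k y) \<partial>lborel) =
      (\<integral>\<^sup>+y\<in>?P ` X. ennreal (k (?Q y)) \<partial>lborel)"
    if k [measurable]: "(\<lambda>y. indicator X y * k y) \<in> borel_measurable borel" for X and k :: "real ^ 'n \<Rightarrow> real"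
  proof -
    have "(\<integral>\<^sup>+y\<in>?P ` X. ennreal (k (?Q y)) \<partial>lborel) =
        (\<integral>\<^sup>+y. ennreal (indicator X (?Q y) * k (?Q y)) \<partial>lborel)"
      unfolding PS by (rule nn_integral_cong) (auto simp: indicator_def)
    also have "\<dots> = (\<integral>\<^sup>+y. ennreal (indicator X y * k y) \<partial>distr lborel borel ?Q)"
      by (subst nn_integral_distr) auto
    also have "\<dots> = (\<integral>\<^sup>+y\<in>X. ennreal (k y) \<partial>lborel)"
      unfolding lborel_reindex[OF bij_imp_bij_inv[OF r]]
      by (rule nn_integral_cong) (auto simp: indicator_def)
    finally show ?thesis by simp
  qed
  have blP: "(?P has_derivative ?P) (at y)" and blQ: "(?Q has_derivative ?Q) (at z)" for y z
    by (rule bounded_linear_imp_has_derivative[OF bounded_linear_reindex])+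
  have der': "(?T has_derivative ?T' x) (at x)" if "x \<in> ?P ` S" for x
  proof -
    have "?Q x \<in> S" using that unfolding PS by simp
    then show ?thesis
      unfolding o_assoc[symmetric] by (intro diff_chain_at blP blQ der)
  qed
  have det: "det (matrix (?T' x)) = det (matrix (T' (?Q x)))" for x
  proof -
    have "?Q (axis j 1) = axis (?r j) 1" for j
      using bij_inv_eq_iff[OF r] by (simp add: reindex_def axis_def vec_eq_iff) metis
    then have "matrix (?T' x) = (\<chi> i j. matrix (T' (?Q x)) $ ?r i $ ?r j)"
      by (auto simp: matrix_def vec_eq_iff) (simp add: reindex_def)
    then show ?thesis by (simp add: det_reindex[OF r])
  qed
  have "(\<integral>\<^sup>+y\<in>T ` S. ennreal (f y) \<partial>lborel) = (\<integral>\<^sup>+y\<in>?T ` (?P ` S). ennreal (f (?Q y)) \<partial>lborel)"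
    unfolding TPS by (rule transfer[OF meas_f])
  also have "\<dots> = (\<integral>\<^sup>+x\<in>?P ` S. ennreal (h (?Q x)) \<partial>lborel)"
  proof (rule nn_integral_change_of_variables_wellorder[OF _ der'])
    show "?P ` S \<in> sets borel"
      unfolding PS by (rule measurable_sets_borel[OF reindex_measurable S])
    show "inj_on ?T (?P ` S)"
    proof (rule inj_onI)
      fix x y assume xy: "x \<in> ?P ` S" "y \<in> ?P ` S" "?T x = ?T y"
      then have "?Q (?T x) = ?Q (?T y)" by simp
      then have "T (?Q x) = T (?Q y)" by simp
      then have "?Q x = ?Q y" using xy(1,2) inj unfolding PS by (auto dest: inj_onD)
      then have "?P (?Q x) = ?P (?Q y)" by simp
      then show "x = y" by simp
    qed
    show "(\<lambda>y. indicator (?T ` ?P ` S) y * f (?Q y)) \<in> borel_measurable borel"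
      unfolding TPS ind by (rule measurable_compose[OF reindex_measurable meas_f])
    show "(\<lambda>y. indicator (?P ` S) y * h (?Q y)) \<in> borel_measurable borel"
      unfolding ind by (rule measurable_compose[OF reindex_measurable meas_h])
    show "0 \<le> f (?Q y)" if "y \<in> ?T ` (?P ` S)" for y
      using that nonneg by auto
    show "h (?Q x) = \<bar>det (matrix (?T' x))\<bar> * f (?Q (?T x))" if "x \<in> ?P ` S" for x
      unfolding det using that h by auto
  qed
  also have "\<dots> = (\<integral>\<^sup>+x\<in>S. ennreal (h x) \<partial>lborel)"
    by (rule transfer[OF meas_h, symmetric])
  finally show ?thesis .
qed

section \<open>Norms given by positive definite matrices\<close>

text \<open>
  The norm of the scalar product with Gram matrix \<open>Q\<close>.
\<close>

definition form_norm :: "real ^ 'n ^ 'n \<Rightarrow> real ^ 'n \<Rightarrow> real" where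
  "form_norm Q w = sqrt (w \<bullet> (Q *v w))"

text \<open>
  By homogeneity the minimum over the compact unit sphere is such a constant.
\<close>

lemma quadratic_form_lower_bound:
  fixes Q :: "real ^ 'n::finite ^ 'n"
  assumes pos: "\<And>w. w \<noteq> 0 \<Longrightarrow> 0 < w \<bullet> (Q *v w)"
  obtains \<kappa> where "\<kappa> > 0" "\<And>w. \<kappa> * (norm w)\<^sup>2 \<le> w \<bullet> (Q *v w)"
proof -
  have cont: "continuous_on (sphere 0 1) (\<lambda>w. w \<bullet> (Q *v w))"
    by (intro continuous_intros linear_continuous_on matrix_vector_mul_bounded_linear)
  have "axis undefined 1 \<in> sphere (0 :: real ^ 'n) 1" by simp
  then have "sphere (0 :: real ^ 'n) 1 \<noteq> {}" by blast
  then obtain w0 where w0: "w0 \<in> sphere 0 1"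
    and min: "\<And>w. w \<in> sphere 0 1 \<Longrightarrow> w0 \<bullet> (Q *v w0) \<le> w \<bullet> (Q *v w)"
    using continuous_attains_inf[OF compact_sphere _ cont] by metis
  show ?thesis
  proof (rule that)
    have "w0 \<noteq> 0" using w0 by auto
    then show "0 < w0 \<bullet> (Q *v w0)" by (rule pos)
    fix w :: "real ^ 'n"
    show "(w0 \<bullet> (Q *v w0)) * (norm w)\<^sup>2 \<le> w \<bullet> (Q *v w)"
    proof (cases "w = 0")
      case False
      let ?u = "w /\<^sub>R norm w"
      have "w0 \<bullet> (Q *v w0) \<le> ?u \<bullet> (Q *v ?u)" using False by (intro min) simp
      also have "\<dots> = (w \<bullet> (Q *v w)) / (norm w)\<^sup>2"
        by (simp add: matrix_vector_mult_scaleR power2_eq_square field_simps)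
      finally show ?thesis using False by (simp add: pos_le_divide_eq)
    qed simp
  qed
qed

lemma quadratic_form_continuous:
  fixes G :: "'b::metric_space \<Rightarrow> real ^ 'n::finite ^ 'n"
  assumes G: "continuous_on S G" and S: "open S" "z0 \<in> S" and e: "\<epsilon> > 0"
  obtains r where "r > 0" "ball z0 r \<subseteq> S"
    "\<And>z w. z \<in> ball z0 r \<Longrightarrow> \<bar>w \<bullet> (G z *v w) - w \<bullet> (G z0 *v w)\<bar> \<le> \<epsilon> * (norm w)\<^sup>2"
proof -
  define N where "N = real CARD('n) * real CARD('n)"
  have N: "N > 0" by (simp add: N_def)
  have "\<epsilon> / N > 0" using e N by simp
  then obtain d where d: "d > 0" "\<And>z. z \<in> S \<Longrightarrow> dist z z0 < d \<Longrightarrow> dist (G z) (G z0) < \<epsilon> / N"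
    using G S(2) unfolding continuous_on_iff by metis
  obtain r0 where r0: "r0 > 0" "ball z0 r0 \<subseteq> S" using S openE by metis
  show ?thesis
  proof (rule that[of "min r0 d"])
    show "min r0 d > 0" "ball z0 (min r0 d) \<subseteq> S" using r0 d(1) by auto
    fix z w assume z: "z \<in> ball z0 (min r0 d)"
    let ?D = "G z - G z0"
    have "norm ?D \<le> \<epsilon> / N" using d(2)[of z] z r0(2) by (auto simp: dist_norm dist_commute)
    moreover have "\<bar>?D $ i $ j\<bar> \<le> norm ?D" for i j
      using Finite_Cartesian_Product.norm_nth_le[of "?D $ i" j] Finite_Cartesian_Product.norm_nth_le[of ?D i] by simp
    ultimately have "onorm ((*v) ?D) \<le> N * (\<epsilon> / N)"
      unfolding N_def by (intro onorm_le_matrix_component) (meson order_trans)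
    then have on: "onorm ((*v) ?D) \<le> \<epsilon>" using N by simp
    have "w \<bullet> (G z *v w) - w \<bullet> (G z0 *v w) = w \<bullet> (?D *v w)"
      by (simp add: matrix_vector_mult_diff_rdistrib inner_diff_right)
    also have "\<bar>\<dots>\<bar> \<le> norm w * norm (?D *v w)" by (rule Cauchy_Schwarz_ineq2)
    also have "\<dots> \<le> norm w * (\<epsilon> * norm w)"
    proof (rule mult_left_mono)
      have "norm (?D *v w) \<le> onorm ((*v) ?D) * norm w"
        by (rule onorm[OF matrix_vector_mul_bounded_linear])
      also have "\<dots> \<le> \<epsilon> * norm w" using on by (rule mult_right_mono) simp
      finally show "norm (?D *v w) \<le> \<epsilon> * norm w" .
    qed simp
    finally show "\<bar>w \<bullet> (G z *v w) - w \<bullet> (G z0 *v w)\<bar> \<le> \<epsilon> * (norm w)\<^sup>2"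
      by (simp add: power2_eq_square mult_ac)
  qed
qed

lemma form_norm_scaleR: "form_norm Q (k *\<^sub>R w) = \<bar>k\<bar> * form_norm Q w"
proof -
  have "(k *\<^sub>R w) \<bullet> (Q *v (k *\<^sub>R w)) = k\<^sup>2 * (w \<bullet> (Q *v w))"
    by (simp add: matrix_vector_mult_scaleR power2_eq_square)
  then show ?thesis by (simp only: form_norm_def real_sqrt_mult real_sqrt_abs)
qed

lemma continuous_on_form_norm [continuous_intros]:
  assumes "continuous_on S G" "continuous_on S D"
  shows "continuous_on S (\<lambda>s. form_norm (G s) (D s))"
  unfolding form_norm_def matrix_vector_mult_def
  by (intro continuous_intros assms)

text \<open>
  Taking square roots only improves relative bounds, because \<open>(1 - \<eta>)\<^sup>2 \<le> 1 - \<eta>\<close> and \<open>1 + \<eta> \<le> (1 + \<eta>)\<^sup>2\<close>.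
\<close>

lemma sqrt_close:
  fixes q q0 \<eta> :: real
  assumes close: "\<bar>q - q0\<bar> \<le> \<eta> * q0" and q0: "0 \<le> q0" and \<eta>: "0 < \<eta>" "\<eta> < 1"
  shows "(1 - \<eta>) * sqrt q0 \<le> sqrt q" "sqrt q \<le> (1 + \<eta>) * sqrt q0"
proof -
  have "\<eta> * \<eta> \<le> \<eta>" "0 \<le> \<eta> * \<eta>" using \<eta> by (simp_all add: mult_left_le)
  then have "(1 - \<eta>)\<^sup>2 \<le> 1 - \<eta>" "1 + \<eta> \<le> (1 + \<eta>)\<^sup>2"
    unfolding power2_eq_square using \<eta> by (simp_all add: algebra_simps)
  then have "(1 - \<eta>)\<^sup>2 * q0 \<le> (1 - \<eta>) * q0" "(1 + \<eta>) * q0 \<le> (1 + \<eta>)\<^sup>2 * q0"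
    using q0 by (simp_all add: mult_right_mono)
  moreover have "(1 - \<eta>) * q0 \<le> q" "q \<le> (1 + \<eta>) * q0"
    using close by (simp_all add: abs_le_iff algebra_simps)
  ultimately have "(1 - \<eta>)\<^sup>2 * q0 \<le> q" "q \<le> (1 + \<eta>)\<^sup>2 * q0"
    by (blast intro: order_trans)+
  then have "sqrt ((1 - \<eta>)\<^sup>2 * q0) \<le> sqrt q" "sqrt q \<le> sqrt ((1 + \<eta>)\<^sup>2 * q0)"
    by (simp_all only: real_sqrt_le_iff)
  then show "(1 - \<eta>) * sqrt q0 \<le> sqrt q" "sqrt q \<le> (1 + \<eta>) * sqrt q0"
    using \<eta> by (simp_all add: real_sqrt_mult)
qed

text \<open>
  A continuous field of scalar products is comparable to its value at \<open>z0\<close> up to a factor close to 1,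
  uniformly in the direction \<open>w\<close>: its change is small compared with the lower bound for the form at \<open>z0\<close>.
\<close>

lemma form_norm_close:
  fixes G :: "'b::metric_space \<Rightarrow> real ^ 'n::finite ^ 'n"
  assumes G: "continuous_on S G" and S: "open S" "z0 \<in> S"
    and pos: "\<And>w. w \<noteq> 0 \<Longrightarrow> 0 < w \<bullet> (G z0 *v w)" and \<eta>: "0 < \<eta>" "\<eta> < 1"
  obtains r where "r > 0" "ball z0 r \<subseteq> S"
    "\<And>z w. z \<in> ball z0 r \<Longrightarrow> (1 - \<eta>) * form_norm (G z0) w \<le> form_norm (G z) w"
    "\<And>z w. z \<in> ball z0 r \<Longrightarrow> form_norm (G z) w \<le> (1 + \<eta>) * form_norm (G z0) w"
proof -
  obtain \<kappa> where \<kappa>: "\<kappa> > 0" "\<And>w. \<kappa> * (norm w)\<^sup>2 \<le> w \<bullet> (G z0 *v w)"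
    using quadratic_form_lower_bound[OF pos] by metis
  have "\<eta> * \<kappa> > 0" using \<eta> \<kappa> by simp
  then obtain r where r: "r > 0" "ball z0 r \<subseteq> S"
    "\<And>z w. z \<in> ball z0 r \<Longrightarrow> \<bar>w \<bullet> (G z *v w) - w \<bullet> (G z0 *v w)\<bar> \<le> (\<eta> * \<kappa>) * (norm w)\<^sup>2"
    using quadratic_form_continuous[OF G S] by metis
  show ?thesis
  proof (rule that[OF r(1,2)])
    fix z w assume z: "z \<in> ball z0 r"
    let ?q = "w \<bullet> (G z *v w)" and ?p = "w \<bullet> (G z0 *v w)"
    have "\<eta> * (\<kappa> * (norm w)\<^sup>2) \<le> \<eta> * ?p" using \<kappa>(2) \<eta> by (intro mult_left_mono) auto
    then have close: "\<bar>?q - ?p\<bar> \<le> \<eta> * ?p" using r(3)[OF z, of w] by (simp add: mult.assoc)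
    have q0: "0 \<le> ?p" using \<kappa>(1) by (intro order_trans[OF _ \<kappa>(2)]) simp
    show "(1 - \<eta>) * form_norm (G z0) w \<le> form_norm (G z) w" "form_norm (G z) w \<le> (1 + \<eta>) * form_norm (G z0) w"
      unfolding form_norm_def using sqrt_close[of ?q ?p \<eta>, OF close q0 \<eta>] by blast+
  qed
qed

text \<open>
  The form is nonnegative at the component of \<open>w\<close> orthogonal to \<open>v\<close>.
\<close>

lemma form_norm_Cauchy_Schwarz:
  fixes Q :: "real ^ 'n::finite ^ 'n"
  assumes pos: "\<And>w. w \<noteq> 0 \<Longrightarrow> 0 < w \<bullet> (Q *v w)"
    and sym: "\<And>w u. w \<bullet> (Q *v u) = u \<bullet> (Q *v w)"
  shows "w \<bullet> (Q *v v) \<le> form_norm Q w * form_norm Q v"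
proof (cases "v = 0")
  case False
  let ?a = "v \<bullet> (Q *v v)" and ?b = "w \<bullet> (Q *v v)" and ?q = "w \<bullet> (Q *v w)"
  have a: "?a > 0" using False by (rule pos)
  let ?u = "w - (?b / ?a) *\<^sub>R v"
  have "0 \<le> ?u \<bullet> (Q *v ?u)" using pos[of ?u] by (cases "?u = 0") auto
  also have "\<dots> = ?q - ?b\<^sup>2 / ?a"
    using a sym[of v w]
    by (simp add: matrix_vector_mult_diff_distrib matrix_vector_mult_scaleR inner_diff_left
        inner_diff_right power2_eq_square)
  finally have "?b\<^sup>2 \<le> ?q * ?a" using a by (simp add: pos_divide_le_eq)
  then have "sqrt (?b\<^sup>2) \<le> sqrt (?q * ?a)" by (simp only: real_sqrt_le_iff)
  then show ?thesis by (simp add: form_norm_def real_sqrt_mult)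
qed (simp add: form_norm_def)

text \<open>
  The matrices on the segment from the identity to \<open>Q\<close> are all positive definite, hence regular, and
  the determinant cannot change its sign along the segment.
\<close>

lemma det_pos_if_positive_definite:
  fixes Q :: "real ^ 'n::finite ^ 'n"
  assumes pos: "\<And>w. w \<noteq> 0 \<Longrightarrow> 0 < w \<bullet> (Q *v w)"
  shows "0 < det Q"
proof (rule ccontr)
  let ?M = "\<lambda>s. (1 - s) *\<^sub>R mat 1 + s *\<^sub>R Q"
  assume "\<not> 0 < det Q"
  then have "det (?M 1) \<le> 0" "0 \<le> det (?M 0)" by (simp_all add: det_I)
  moreover have "continuous_on {0..1} (\<lambda>s. det (?M s))"
    unfolding det_def by (intro continuous_intros)
  ultimately obtain s where s: "0 \<le> s" "s \<le> 1" "det (?M s) = 0"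
    using IVT2'[of "\<lambda>s. det (?M s)" 1 0 0] by auto
  then obtain w where w: "w \<noteq> 0" "?M s *v w = 0"
    using invertible_det_nz[of "?M s"] invertible_left_inverse[of "?M s"]
      matrix_left_invertible_ker[of "?M s"] by metis
  have "w \<bullet> (?M s *v w) = (1 - s) * (w \<bullet> w) + s * (w \<bullet> (Q *v w))"
    by (simp add: matrix_vector_mult_add_rdistrib scaleR_matrix_vector_assoc[symmetric] inner_add_right)
  moreover have "0 < (1 - s) * (w \<bullet> w) + s * (w \<bullet> (Q *v w))"
  proof (cases "s = 0")
    case False
    then show ?thesis using s pos[OF w(1)] by (intro add_nonneg_pos) auto
  qed (use w in simp)
  ultimately show False using w(2) by simp
qed

text \<open>
  Polarization, using the symmetry of both matrices.
\<close>

lemma symmetric_form_eq: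
  fixes P Q :: "real ^ 'n::finite ^ 'n"
  assumes diag: "\<And>w. w \<bullet> (P *v w) = w \<bullet> (Q *v w)"
    and P: "\<And>w u. w \<bullet> (P *v u) = u \<bullet> (P *v w)" and Q: "\<And>w u. w \<bullet> (Q *v u) = u \<bullet> (Q *v w)"
  shows "P = Q"
proof -
  have polar: "(w + u) \<bullet> (R *v (w + u)) = w \<bullet> (R *v w) + w \<bullet> (R *v u) + u \<bullet> (R *v w) + u \<bullet> (R *v u)"
    for R :: "real ^ 'n ^ 'n" and w u
    by (simp add: matrix_vector_right_distrib inner_add_left inner_add_right)
  have "w \<bullet> (P *v u) = w \<bullet> (Q *v u)" for w u
    using polar[of w u P] polar[of w u Q] diag[of w] diag[of u] diag[of "w + u"] P[of u w] Q[of u w] by linarith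
  then have "P *v u = Q *v u" for u by (metis vector_eq_ldot)
  then show ?thesis by (simp add: matrix_eq)
qed

section \<open>Charts and tangent vectors\<close>

lemma C_k_on_imp_continuous_on: "C_k_on k S f \<Longrightarrow> continuous_on S f"
  by (cases k) (auto intro: continuous_at_imp_continuous_on differentiable_imp_continuous_within)

lemma inner_product_onD:
  assumes "inner_product_on V ip"
  shows "u \<in> V \<Longrightarrow> v \<in> V \<Longrightarrow> ip u v = ip v u"
    and "u \<in> V \<Longrightarrow> u' \<in> V \<Longrightarrow> v \<in> V \<Longrightarrow>
      ip (\<lambda>c. a *\<^sub>R u c + b *\<^sub>R u' c) v = a * ip u v + b * ip u' v"
    and "v \<in> V \<Longrightarrow> v \<noteq> (\<lambda>_. 0) \<Longrightarrow> 0 < ip v v"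
  using assms unfolding inner_product_on_def by blast+

lemma linear_expand_axis:
  fixes f :: "real ^ 'n::finite \<Rightarrow> real"
  assumes "linear f"
  shows "f w = (\<Sum>i\<in>UNIV. w $ i * f (axis i 1))"
proof -
  have "f w = f (\<Sum>i\<in>UNIV. w $ i *\<^sub>R axis i 1)"
    using basis_expansion[of w] by (simp add: scalar_mult_eq_scaleR)
  then show ?thesis using assms by (simp add: linear_sum linear_scale)
qed

locale smooth_manifold =
  fixes A :: "('a::t2_space, 'n::finite) chart set"
  assumes smooth_atlas: "smooth_atlas A"
begin

lemma chart:
  assumes "c \<in> A"
  shows open_chart_dom: "open (chart_dom c)"
    and open_chart_image: "open (chart_image c)"
    and continuous_chart_map: "continuous_on (chart_dom c) (chart_map c)"
    and continuous_chart_inv: "continuous_on (chart_image c) (chart_inv c)"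
    and chart_inv_map: "x \<in> chart_dom c \<Longrightarrow> chart_inv c (chart_map c x) = x"
    and chart_map_inv: "z \<in> chart_image c \<Longrightarrow> chart_map c (chart_inv c z) = z"
    and chart_inv_in_dom: "z \<in> chart_image c \<Longrightarrow> chart_inv c z \<in> chart_dom c"
proof -
  have "open (chart_dom c) \<and> open (chart_image c) \<and>
     homeomorphism (chart_dom c) (chart_image c) (chart_map c) (chart_inv c)"
    using smooth_atlas assms unfolding smooth_atlas_def is_chart_def by blast
  note h = this[THEN conjunct1] this[THEN conjunct2, THEN conjunct1]
    this[THEN conjunct2, THEN conjunct2, unfolded homeomorphism_def]
  show "open (chart_dom c)" "open (chart_image c)" by (fact h)+
  show "continuous_on (chart_dom c) (chart_map c)" "continuous_on (chart_image c) (chart_inv c)"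
    "x \<in> chart_dom c \<Longrightarrow> chart_inv c (chart_map c x) = x"
    "z \<in> chart_image c \<Longrightarrow> chart_map c (chart_inv c z) = z"
    "z \<in> chart_image c \<Longrightarrow> chart_inv c z \<in> chart_dom c"
    using h(3) by auto
qed

lemma chart_around: obtains c where "c \<in> A" "x \<in> chart_dom c"
  using smooth_atlas unfolding smooth_atlas_def by blast

lemma inj_on_chart_map: "c \<in> A \<Longrightarrow> inj_on (chart_map c) (chart_dom c)"
  by (metis inj_on_inverseI chart_inv_map)

lemma chart_map_image_eq:
  assumes "c \<in> A" "W \<subseteq> chart_dom c"
  shows "chart_map c ` W = chart_image c \<inter> chart_inv c -` W"
  using assms chart_inv_map[OF assms(1)] chart_map_inv[OF assms(1)] by (auto 4 3 simp: image_iff)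

lemma chart_inv_image_eq:
  assumes "c \<in> A" "V \<subseteq> chart_image c"
  shows "chart_inv c ` V = chart_dom c \<inter> chart_map c -` V"
proof
  show "chart_inv c ` V \<subseteq> chart_dom c \<inter> chart_map c -` V"
    using assms chart_inv_in_dom[OF assms(1)] chart_map_inv[OF assms(1)] by auto
  show "chart_dom c \<inter> chart_map c -` V \<subseteq> chart_inv c ` V"
    using chart_inv_map[OF assms(1)] by (metis IntD1 IntD2 image_eqI subsetI vimageD)
qed

lemma open_chart_map_image:
  assumes "c \<in> A" "open W" "W \<subseteq> chart_dom c"
  shows "open (chart_map c ` W)"
  unfolding chart_map_image_eq[OF assms(1,3)]
  using assms chart[OF assms(1)] by (intro continuous_open_preimage) auto

lemma open_chart_inv_image:
  assumes "c \<in> A" "open V" "V \<subseteq> chart_image c"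
  shows "open (chart_inv c ` V)"
  unfolding chart_inv_image_eq[OF assms(1,3)]
  using assms chart[OF assms(1)] by (intro continuous_open_preimage) auto

lemma borel_chart_map_image:
  assumes "c \<in> A" "B \<in> sets borel" "B \<subseteq> chart_dom c"
  shows "chart_map c ` B \<in> sets borel"
proof -
  have "chart_inv c \<in> borel_measurable (restrict_space borel (chart_image c))"
    by (intro borel_measurable_continuous_on_restrict continuous_chart_inv assms)
  from measurable_sets[OF this assms(2)] show ?thesis
    unfolding chart_map_image_eq[OF assms(1,3)]
    using open_chart_image[OF assms(1)]
    by (simp add: space_restrict_space sets_restrict_space_iff Int_commute)
qed

abbreviation J :: "('a, 'n) chart \<Rightarrow> ('a, 'n) chart \<Rightarrow> 'a \<Rightarrow> real ^ 'n \<Rightarrow> real ^ 'n" where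
  "J c c' x \<equiv> frechet_derivative (transition c c') (at (chart_map c x))"

lemma transition_chart_map:
  assumes "c \<in> A" "x \<in> chart_dom c"
  shows "transition c c' (chart_map c x) = chart_map c' x"
  using assms by (simp add: transition_def chart_inv_map)

lemma C_k_transition:
  assumes "c \<in> A" "c' \<in> A"
  shows "C_k_on k (chart_map c ` (chart_dom c \<inter> chart_dom c')) (transition c c')"
  using smooth_atlas assms unfolding smooth_atlas_def C_infinity_on_def by blast

lemma transition_has_derivative:
  assumes "c \<in> A" "c' \<in> A" "x \<in> chart_dom c" "x \<in> chart_dom c'"
  shows "(transition c c' has_derivative J c c' x) (at (chart_map c x))"
  using C_k_transition[OF assms(1,2), of 1] assms(3,4)
  by (simp add: frechet_derivative_works[symmetric])

lemma continuous_on_transition_derivative: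
  assumes "c \<in> A" "c' \<in> A"
  shows "continuous_on (chart_map c ` (chart_dom c \<inter> chart_dom c'))
    (\<lambda>z. frechet_derivative (transition c c') (at z) v)"
  using C_k_transition[OF assms, of 1] by simp

lemma linear_J: "c \<in> A \<Longrightarrow> c' \<in> A \<Longrightarrow> x \<in> chart_dom c \<Longrightarrow> x \<in> chart_dom c' \<Longrightarrow> linear (J c c' x)"
  by (rule has_derivative_linear[OF transition_has_derivative])

text \<open>
  The chain rule for transition maps.
\<close>

lemma J_cocycle:
  assumes c: "c \<in> A" "c' \<in> A" "c'' \<in> A"
    and x: "x \<in> chart_dom c" "x \<in> chart_dom c'" "x \<in> chart_dom c''"
  shows "J c c'' x = J c' c'' x \<circ> J c c' x"
proof (rule has_derivative_unique)
  show "(transition c c'' has_derivative J c c'' x) (at (chart_map c x))"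
    using assms by (intro transition_has_derivative)
  let ?V = "chart_map c ` (chart_dom c \<inter> chart_dom c' \<inter> chart_dom c'')"
  have "((transition c' c'' \<circ> transition c c') has_derivative (J c' c'' x \<circ> J c c' x)) (at (chart_map c x))"
    using transition_has_derivative[OF c(1,2) x(1,2)] transition_has_derivative[OF c(2,3) x(2,3)]
    by (intro diff_chain_at) (simp_all add: transition_chart_map c x)
  then show "(transition c c'' has_derivative (J c' c'' x \<circ> J c c' x)) (at (chart_map c x))"
  proof (rule has_derivative_transform_within_open)
    show "open ?V"
      using c by (intro open_chart_map_image open_Int open_chart_dom) auto
    show "chart_map c x \<in> ?V" using x by auto
    show "(transition c' c'' \<circ> transition c c') z = transition c c'' z" if "z \<in> ?V" for z
      using that c by (auto simp: transition_chart_map)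
  qed
qed

lemma J_self: "c \<in> A \<Longrightarrow> x \<in> chart_dom c \<Longrightarrow> J c c x = id"
proof (rule has_derivative_unique)
  assume c: "c \<in> A" and x: "x \<in> chart_dom c"
  show "(transition c c has_derivative J c c x) (at (chart_map c x))"
    using c x by (intro transition_has_derivative)
  show "(transition c c has_derivative id) (at (chart_map c x))"
    by (rule has_derivative_transform_within_open[OF has_derivative_id open_chart_image[OF c]])
      (use c x in \<open>auto simp: transition_chart_map id_def\<close>)
qed

abbreviation T :: "('a, 'n) chart \<Rightarrow> 'a \<Rightarrow> real ^ 'n \<Rightarrow> ('a, 'n) tangent_vector" where
  "T c x w \<equiv> tangent_of_coords A c x w"

lemma tangent_of_coords_change:
  assumes "c \<in> A" "c' \<in> A" "x \<in> chart_dom c" "x \<in> chart_dom c'"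
  shows "T c x w = T c' x (J c c' x w)"
proof
  fix c''
  show "T c x w c'' = T c' x (J c c' x w) c''"
  proof (cases "c'' \<in> charts_at A x")
    case True
    then have "c'' \<in> A" "x \<in> chart_dom c''" by (auto simp: charts_at_def)
    then have "J c c'' x = J c' c'' x \<circ> J c c' x" using assms by (intro J_cocycle)
    then show ?thesis by (simp add: tangent_of_coords_def)
  qed (simp add: tangent_of_coords_def)
qed

lemma tangent_of_coords_in:
  assumes "c \<in> A" "x \<in> chart_dom c"
  shows "T c x w \<in> tangent_space A x"
  unfolding tangent_space_def
proof (intro CollectI conjI allI impI ballI)
  fix c' c'' assume "c' \<in> charts_at A x" "c'' \<in> charts_at A x"
  then show "T c x w c'' = J c' c'' x (T c x w c')"
    using J_cocycle[of c c' c'' x] assms by (simp add: tangent_of_coords_def charts_at_def)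
qed (simp add: tangent_of_coords_def)

lemma tangent_of_coords_apply:
  assumes "c \<in> A" "x \<in> chart_dom c"
  shows "T c x w c = w"
  using assms by (auto simp: tangent_of_coords_def charts_at_def J_self)

lemma tangent_of_coords_surj:
  assumes "c \<in> A" "x \<in> chart_dom c" "v \<in> tangent_space A x"
  shows "T c x (v c) = v"
proof
  fix c'
  have "c \<in> charts_at A x" using assms(1,2) by (simp add: charts_at_def)
  then have "c' \<in> charts_at A x \<Longrightarrow> v c' = J c c' x (v c)" "c' \<notin> charts_at A x \<Longrightarrow> v c' = 0"
    using assms(3) unfolding tangent_space_def by blast+
  then show "T c x (v c) c' = v c'"
    unfolding tangent_of_coords_def by presburger
qed

lemma tangent_of_coords_linear:
  assumes "c \<in> A" "x \<in> chart_dom c"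
  shows "T c x (a *\<^sub>R w + b *\<^sub>R w') = (\<lambda>c'. a *\<^sub>R T c x w c' + b *\<^sub>R T c x w' c')"
proof
  fix c'
  show "T c x (a *\<^sub>R w + b *\<^sub>R w') c' = a *\<^sub>R T c x w c' + b *\<^sub>R T c x w' c'"
    using linear_J[OF assms(1) _ assms(2), of c']
    by (simp add: tangent_of_coords_def charts_at_def linear_add linear_scale)
qed

end

text \<open>
  A metric of class \<open>C\<^sup>k\<close> is in particular continuous; see \<open>riemannian_metric_continuous\<close>.
\<close>

locale continuous_metric = smooth_manifold A
  for A :: "('a::t2_space, 'n::finite) chart set" +
  fixes g :: "('a, 'n) metric_field"
  assumes metric: "riemannian_metric 0 A g"
begin

lemma inner_product: "inner_product_on (tangent_space A x) (g x)"
  using metric unfolding riemannian_metric_def by blast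

lemma metric_linear:
  assumes "c \<in> A" "x \<in> chart_dom c"
  shows metric_linear_left: "linear (\<lambda>w. g x (T c x w) (T c x u))"
    and metric_linear_right: "linear (\<lambda>w. g x (T c x u) (T c x w))"
proof -
  note ip = inner_product_onD[OF inner_product[of x]]
  note t = tangent_of_coords_in[OF assms]
  have 1: "g x (T c x (a *\<^sub>R w + b *\<^sub>R w')) (T c x u) = a * g x (T c x w) (T c x u) + b * g x (T c x w') (T c x u)"
    for a b w w'
    unfolding tangent_of_coords_linear[OF assms] by (rule ip(2)[OF t t t])
  show lin: "linear (\<lambda>w. g x (T c x w) (T c x u))"
    using 1[of 1 _ 1] 1[of _ _ 0] by (intro linearI) auto
  have "(\<lambda>w. g x (T c x u) (T c x w)) = (\<lambda>w. g x (T c x w) (T c x u))"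
    using ip(1)[OF t t] by auto
  then show "linear (\<lambda>w. g x (T c x u) (T c x w))" using lin by simp
qed

lemma metric_coords:
  assumes "c \<in> A" "x \<in> chart_dom c"
  shows "g x (T c x w) (T c x u) = w \<bullet> (metric_matrix A g c x *v u)"
proof -
  have "g x (T c x w) (T c x u) = (\<Sum>i\<in>UNIV. w $ i * g x (T c x (axis i 1)) (T c x u))"
    by (rule linear_expand_axis[OF metric_linear_left[OF assms]])
  also have "\<dots> = (\<Sum>i\<in>UNIV. w $ i * (\<Sum>j\<in>UNIV. u $ j * g x (T c x (axis i 1)) (T c x (axis j 1))))"
    by (subst linear_expand_axis[OF metric_linear_right[OF assms], of _ u]) (rule refl)
  also have "\<dots> = w \<bullet> (metric_matrix A g c x *v u)"
    by (simp add: inner_vec_def matrix_vector_mult_def metric_matrix_def mult.commute)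
  finally show ?thesis .
qed

lemma metric_matrix_symmetric:
  assumes "c \<in> A" "x \<in> chart_dom c"
  shows "w \<bullet> (metric_matrix A g c x *v u) = u \<bullet> (metric_matrix A g c x *v w)"
  unfolding metric_coords[OF assms, symmetric]
  by (rule inner_product_onD[OF inner_product]) (rule tangent_of_coords_in[OF assms])+

lemma metric_matrix_pos:
  assumes "c \<in> A" "x \<in> chart_dom c" "w \<noteq> 0"
  shows "0 < w \<bullet> (metric_matrix A g c x *v w)"
proof -
  have "T c x w \<noteq> (\<lambda>_. 0)"
    using tangent_of_coords_apply[OF assms(1,2), of w] assms(3) by metis
  then show ?thesis
    unfolding metric_coords[OF assms(1,2), symmetric]
    by (intro inner_product_onD(3)[OF inner_product] tangent_of_coords_in[OF assms(1,2)])
qed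

lemma continuous_metric_matrix:
  assumes "c \<in> A"
  shows "continuous_on (chart_image c) (\<lambda>z. metric_matrix A g c (chart_inv c z))"
  using metric assms unfolding riemannian_metric_def by (auto intro: C_k_on_imp_continuous_on)

lemma continuous_metric_matrix_dom:
  assumes "c \<in> A"
  shows "continuous_on (chart_dom c) (metric_matrix A g c)"
proof -
  have "continuous_on (chart_dom c) (\<lambda>x. metric_matrix A g c (chart_inv c (chart_map c x)))"
    by (rule continuous_on_compose2[OF continuous_metric_matrix continuous_chart_map]) (use assms in auto)
  then show ?thesis
    by (rule continuous_on_eq) (use assms in \<open>simp add: chart_inv_map\<close>)
qed

text \<open>
  Since \<open>T c x w = T c' x (J c c' x w)\<close>, both matrices represent the same form \<open>g x\<close>. Its consequence
  \<open>det_metric_change\<close> is what makes the coordinate expressions for the volume independent of the chart.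
\<close>

lemma metric_matrix_change:
  assumes c: "c \<in> A" "c' \<in> A" and x: "x \<in> chart_dom c" "x \<in> chart_dom c'"
  shows "metric_matrix A g c x =
    transpose (matrix (J c c' x)) ** metric_matrix A g c' x ** matrix (J c c' x)"
proof -
  let ?G = "metric_matrix A g c x" and ?G' = "metric_matrix A g c' x" and ?M = "matrix (J c c' x)"
  have "w \<bullet> (?G *v u) = w \<bullet> ((transpose ?M ** ?G' ** ?M) *v u)" for w u
  proof -
    have J: "?M *v v = J c c' x v" for v
      by (simp only: matrix_vector_mul(2)[OF linear_J[OF c x]])
    have "w \<bullet> (?G *v u) = g x (T c x w) (T c x u)"
      by (rule metric_coords[OF c(1) x(1), symmetric])
    also have "\<dots> = g x (T c' x (?M *v w)) (T c' x (?M *v u))"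
      unfolding J by (rule arg_cong2[where f = "g x"]; rule tangent_of_coords_change[OF c x])
    also have "\<dots> = (?M *v w) \<bullet> (?G' *v (?M *v u))"
      by (rule metric_coords[OF c(2) x(2)])
    also have "\<dots> = w \<bullet> (transpose ?M *v (?G' *v (?M *v u)))"
      by (metis vector_transpose_matrix dot_lmul_matrix)
    finally show ?thesis
      by (simp only: matrix_vector_mul_assoc matrix_mul_assoc)
  qed
  then show ?thesis
    unfolding matrix_eq by (metis vector_eq_ldot)
qed

lemma det_metric_change:
  assumes c: "c \<in> A" "c' \<in> A" and x: "x \<in> chart_dom c" "x \<in> chart_dom c'"
  shows "sqrt (det (metric_matrix A g c x)) =
    \<bar>det (matrix (J c c' x))\<bar> * sqrt (det (metric_matrix A g c' x))"
proof -
  have "det (metric_matrix A g c x) = (det (matrix (J c c' x)))\<^sup>2 * det (metric_matrix A g c' x)"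
    unfolding metric_matrix_change[OF assms] by (simp only: det_mul det_transpose power2_eq_square ac_simps)
  then show ?thesis by (simp only: real_sqrt_mult real_sqrt_abs)
qed

end

section \<open>Curves and their speed\<close>

lemma piecewise_C1_curveE:
  assumes "piecewise_C1_curve A \<gamma>"
  obtains n \<tau> where "\<tau> 0 = 0" "\<tau> n = 1" "\<And>i. i \<le> n \<Longrightarrow> 0 \<le> \<tau> i \<and> \<tau> i \<le> 1"
    "\<And>i. i < n \<Longrightarrow> \<tau> i < \<tau> (Suc i) \<and> C1_curve_on A \<gamma> (\<tau> i) (\<tau> (Suc i))"
proof -
  obtain n \<tau> where \<tau>: "\<tau> 0 = 0" "\<tau> n = 1"
    and step: "\<And>i. i < n \<Longrightarrow> \<tau> i < \<tau> (Suc i) \<and> C1_curve_on A \<gamma> (\<tau> i) (\<tau> (Suc i))"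
    using assms unfolding piecewise_C1_curve_def by blast
  have "\<tau> i \<le> 1" if "i \<le> n" for i
    using that
  proof (induction i rule: inc_induct)
    case (step m)
    then show ?case using \<open>\<And>i. i < n \<Longrightarrow> _\<close>[of m] by auto
  qed (simp add: \<tau>)
  moreover have "0 \<le> \<tau> i" if "i \<le> n" for i
    using that
  proof (induction i)
    case (Suc i)
    then show ?case using step[of i] by auto
  qed (simp add: \<tau>)
  ultimately show ?thesis using that[OF \<tau> _ step] by blast
qed

text \<open>
  A property of initial intervals \<open>{0..b}\<close> that extends across every \<open>C\<^sup>1\<close> piece holds for the whole
  curve. This hides the subdivision in the proofs below.
\<close>

lemma piecewise_C1_curve_induct [consumes 1, case_names start piece]:
  assumes \<gamma>: "piecewise_C1_curve A \<gamma>"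
    and start: "P 0"
    and piece: "\<And>a b. 0 \<le> a \<Longrightarrow> a < b \<Longrightarrow> b \<le> 1 \<Longrightarrow> C1_curve_on A \<gamma> a b \<Longrightarrow> P a \<Longrightarrow> P b"
  shows "P (1 :: real)"
proof -
  obtain n \<tau> where \<tau>: "\<tau> 0 = 0" "\<tau> n = 1" "\<And>i. i \<le> n \<Longrightarrow> 0 \<le> \<tau> i \<and> \<tau> i \<le> 1"
    and step: "\<And>i. i < n \<Longrightarrow> \<tau> i < \<tau> (Suc i) \<and> C1_curve_on A \<gamma> (\<tau> i) (\<tau> (Suc i))"
    by (rule piecewise_C1_curveE[OF \<gamma>]) blast
  have "P (\<tau> i)" if "i \<le> n" for i
    using that
  proof (induction i)
    case (Suc i)
    then show ?case using step[of i] \<tau>(3)[of i] \<tau>(3)[of "Suc i"] piece[of "\<tau> i" "\<tau> (Suc i)"] by auto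
  qed (simp add: \<tau>(1) start)
  then show ?thesis using \<tau>(2) by (metis order_refl)
qed

lemma piecewise_C1_curve_continuous:
  assumes "piecewise_C1_curve A \<gamma>"
  shows "continuous_on {0..1} \<gamma>"
  using assms
proof (induction rule: piecewise_C1_curve_induct)
  case (piece a b)
  then have "continuous_on ({0..a} \<union> {a..b}) \<gamma>"
    by (intro continuous_on_closed_Un) (auto simp: C1_curve_on_def)
  then show ?case using piece by (simp add: ivl_disj_un)
qed simp

lemma piecewise_C1_curve_differentiable:
  assumes "piecewise_C1_curve A \<gamma>"
  obtains F where "finite F"
    "\<And>s c. s \<in> {0<..<1} - F \<Longrightarrow> c \<in> A \<Longrightarrow> \<gamma> s \<in> chart_dom c \<Longrightarrow>
      (chart_map c \<circ> \<gamma>) differentiable (at s)"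
proof -
  have "\<exists>F. finite F \<and> (\<forall>s\<in>{0<..<1} - F. \<forall>c\<in>A. \<gamma> s \<in> chart_dom c \<longrightarrow>
      (chart_map c \<circ> \<gamma>) differentiable (at s))"
    using assms
  proof (induction rule: piecewise_C1_curve_induct)
    case (piece a b)
    then obtain F where F: "finite F" "\<And>s c. s \<in> {0<..<a} - F \<Longrightarrow> c \<in> A \<Longrightarrow> \<gamma> s \<in> chart_dom c \<Longrightarrow>
      (chart_map c \<circ> \<gamma>) differentiable (at s)" by blast
    show ?case
    proof (intro exI[of _ "insert a F"] conjI ballI impI)
      fix s c assume s: "s \<in> {0<..<b} - insert a F" and c: "c \<in> A" "\<gamma> s \<in> chart_dom c"
      show "(chart_map c \<circ> \<gamma>) differentiable (at s)"
      proof (cases "s < a")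
        case True
        then show ?thesis using F(2) s c by simp
      next
        case False
        then have sab: "a < s" "s < b" using s by auto
        then have "\<exists>D. ((chart_map c \<circ> \<gamma>) has_vector_derivative D) (at s within {a..b})"
          using piece(4) c unfolding C1_curve_on_def by force
        then show ?thesis
          unfolding at_within_Icc_at[OF sab]
          by (auto simp: has_vector_derivative_def intro: differentiableI)
      qed
    qed (simp add: F(1))
  qed (auto intro: exI[of _ "{}"])
  then show ?thesis using that by blast
qed

lemma continuous_on_stays_in_open:
  fixes \<gamma> :: "real \<Rightarrow> 'a::topological_space"
  assumes "continuous_on S \<gamma>" "open U" "s \<in> S" "\<gamma> s \<in> U"
  obtains d where "d > 0" "\<And>s'. s' \<in> S \<Longrightarrow> dist s' s < d \<Longrightarrow> \<gamma> s' \<in> U"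
proof -
  have "(\<gamma> \<longlongrightarrow> \<gamma> s) (at s within S)" using assms by (simp add: continuous_on_def)
  then have "\<forall>\<^sub>F s' in at s within S. \<gamma> s' \<in> U" using assms by (simp add: tendsto_def)
  then obtain d where "d > 0" "\<And>s'. s' \<in> S \<Longrightarrow> s' \<noteq> s \<Longrightarrow> dist s' s < d \<Longrightarrow> \<gamma> s' \<in> U"
    unfolding eventually_at by blast
  then show ?thesis using that assms(4) by metis
qed

text \<open>
  The velocity formed with one-sided derivatives at the ends of \<open>{a..b}\<close>. On a \<open>C\<^sup>1\<close> piece it
  is continuous up to the ends, where it may differ from \<open>velocity\<close>.
\<close>

definition velocity_on ::
  "('a, 'n::finite) chart set \<Rightarrow> real \<Rightarrow> real \<Rightarrow> (real \<Rightarrow> 'a) \<Rightarrow> real \<Rightarrow> ('a, 'n) tangent_vector" where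
  "velocity_on A a b \<gamma> s = (\<lambda>c. if c \<in> charts_at A (\<gamma> s)
     then vector_derivative (chart_map c \<circ> \<gamma>) (at s within {a..b}) else 0)"

lemma velocity_eq_velocity_on: "velocity A \<gamma> s = velocity_on A 0 1 \<gamma> s"
  by (simp add: velocity_def velocity_on_def)

lemma velocity_on_interior:
  assumes "0 \<le> a" "a < s" "s < b" "b \<le> 1"
  shows "velocity A \<gamma> s = velocity_on A a b \<gamma> s"
proof -
  have "at s within {0..1} = at s" "at s within {a..b} = at s"
    using assms by (auto intro!: at_within_Icc_at)
  then show ?thesis by (simp only: velocity_def velocity_on_def)
qed

context smooth_manifold
begin

text \<open>
  By the chain rule one chart is enough to compute the velocity in all of them.
\<close>

lemma velocity_on_eq:
  assumes ab: "a < b" "s \<in> {a..b}" and \<gamma>: "continuous_on {a..b} \<gamma>"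
    and c: "c \<in> A" "\<gamma> s \<in> chart_dom c"
    and D: "((chart_map c \<circ> \<gamma>) has_vector_derivative D) (at s within {a..b})"
  shows "velocity_on A a b \<gamma> s = T c (\<gamma> s) D"
proof
  fix c'
  show "velocity_on A a b \<gamma> s c' = T c (\<gamma> s) D c'"
  proof (cases "c' \<in> charts_at A (\<gamma> s)")
    case True
    then have c': "c' \<in> A" "\<gamma> s \<in> chart_dom c'" by (auto simp: charts_at_def)
    have "open (chart_dom c \<inter> chart_dom c')" using c c' by (intro open_Int open_chart_dom)
    then obtain d where d: "d > 0"
      "\<And>s'. s' \<in> {a..b} \<Longrightarrow> dist s' s < d \<Longrightarrow> \<gamma> s' \<in> chart_dom c \<inter> chart_dom c'"
      using continuous_on_stays_in_open[OF \<gamma> _ ab(2), of "chart_dom c \<inter> chart_dom c'"] c c' by blast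
    have "(transition c c' has_derivative J c c' (\<gamma> s)) (at ((chart_map c \<circ> \<gamma>) s))"
      using transition_has_derivative[OF c(1) c'(1) c(2) c'(2)] by simp
    from vector_derivative_diff_chain_within[OF D has_derivative_at_withinI[OF this]]
    have "((transition c c' \<circ> (chart_map c \<circ> \<gamma>)) has_vector_derivative J c c' (\<gamma> s) D) (at s within {a..b})" .
    then have "((chart_map c' \<circ> \<gamma>) has_vector_derivative J c c' (\<gamma> s) D) (at s within {a..b})"
    proof (rule has_vector_derivative_transform_within[OF _ d(1) ab(2)])
      fix s' assume "s' \<in> {a..b}" "dist s' s < d"
      from d(2)[OF this] show "(transition c c' \<circ> (chart_map c \<circ> \<gamma>)) s' = (chart_map c' \<circ> \<gamma>) s'"
        by (simp add: transition_chart_map[OF c(1)])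
    qed
    from vector_derivative_within_closed_interval[OF ab this] True show ?thesis
      by (simp add: velocity_on_def tangent_of_coords_def)
  qed (simp add: velocity_on_def tangent_of_coords_def)
qed

end

context continuous_metric
begin

abbreviation G :: "('a, 'n) chart \<Rightarrow> 'a \<Rightarrow> real ^ 'n ^ 'n" where
  "G c x \<equiv> metric_matrix A g c x"

abbreviation speed :: "(real \<Rightarrow> 'a) \<Rightarrow> real \<Rightarrow> real" where
  "speed \<gamma> s \<equiv> sqrt (g (\<gamma> s) (velocity A \<gamma> s) (velocity A \<gamma> s))"

lemma speed_eq_form_norm:
  assumes s: "s \<in> {0<..<1}" and \<gamma>: "continuous_on {0..1} \<gamma>"
    and c: "c \<in> A" "\<gamma> s \<in> chart_dom c"
    and D: "((chart_map c \<circ> \<gamma>) has_vector_derivative D) (at s)"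
  shows "speed \<gamma> s = form_norm (G c (\<gamma> s)) D"
proof -
  have "velocity_on A 0 1 \<gamma> s = T c (\<gamma> s) D"
    using s by (intro velocity_on_eq \<gamma> c has_vector_derivative_at_within[OF D]) auto
  then show ?thesis
    by (simp add: velocity_eq_velocity_on metric_coords[OF c] form_norm_def)
qed

lemma speed_on_piece_continuous:
  assumes ab: "a < b" and \<gamma>: "C1_curve_on A \<gamma> a b"
  shows "continuous_on {a..b} (\<lambda>s. sqrt (g (\<gamma> s) (velocity_on A a b \<gamma> s) (velocity_on A a b \<gamma> s)))"
    (is "continuous_on _ ?h")
  unfolding continuous_on_eq_continuous_within
proof
  fix s assume s: "s \<in> {a..b}"
  have cont: "continuous_on {a..b} \<gamma>" using \<gamma> by (simp add: C1_curve_on_def)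
  obtain c where c: "c \<in> A" "\<gamma> s \<in> chart_dom c" by (rule chart_around)
  let ?S = "{s\<in>{a..b}. \<gamma> s \<in> chart_dom c}"
  obtain D where D: "continuous_on ?S D"
    "\<And>s. s \<in> {a..b} \<Longrightarrow> \<gamma> s \<in> chart_dom c \<Longrightarrow>
      ((chart_map c \<circ> \<gamma>) has_vector_derivative D s) (at s within {a..b})"
    using \<gamma> c(1) unfolding C1_curve_on_def by blast
  have eq: "?h s' = form_norm (G c (\<gamma> s')) (D s')" if "s' \<in> ?S" for s'
    using that velocity_on_eq[OF ab _ cont c(1) _ D(2)]
    by (simp add: metric_coords[OF c(1)] form_norm_def)
  have "continuous_on ?S (\<lambda>s'. G c (\<gamma> s'))"
    by (rule continuous_on_compose2[OF continuous_metric_matrix_dom[OF c(1)] continuous_on_subset[OF cont]]) auto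
  then have "continuous_on ?S (\<lambda>s'. form_norm (G c (\<gamma> s')) (D s'))"
    by (intro continuous_intros D(1))
  then have "continuous_on ?S ?h"
    by (rule continuous_on_eq) (simp only: eq)
  then have "continuous (at s within ?S) ?h"
    using s c unfolding continuous_on_eq_continuous_within by blast
  moreover have "at s within {a..b} = at s within ?S"
  proof -
    obtain d where d: "d > 0" "\<And>s'. s' \<in> {a..b} \<Longrightarrow> dist s' s < d \<Longrightarrow> \<gamma> s' \<in> chart_dom c"
      using continuous_on_stays_in_open[OF cont open_chart_dom[OF c(1)] s c(2)] by metis
    show ?thesis
      by (rule at_within_nhd[of _ "ball s d"]) (use d in \<open>auto simp: dist_commute\<close>)
  qed
  ultimately show "continuous (at s within {a..b}) ?h" by simp
qed

text \<open>
  On each piece the speed agrees, except at the two ends, with a continuous function.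
\<close>

lemma speed_integrable:
  assumes "piecewise_C1_curve A \<gamma>"
  shows "speed \<gamma> integrable_on {0..1}"
  using assms
proof (induction rule: piecewise_C1_curve_induct)
  case (piece a b)
  have "speed \<gamma> integrable_on {a..b}"
  proof (rule integrable_spike_finite)
    show "(\<lambda>s. sqrt (g (\<gamma> s) (velocity_on A a b \<gamma> s) (velocity_on A a b \<gamma> s))) integrable_on {a..b}"
      using piece by (intro integrable_continuous_real speed_on_piece_continuous)
    show "finite {a, b}" by simp
    fix s assume "s \<in> {a..b} - {a, b}"
    then have "velocity A \<gamma> s = velocity_on A a b \<gamma> s"
      using piece by (intro velocity_on_interior) auto
    then show "speed \<gamma> s = sqrt (g (\<gamma> s) (velocity_on A a b \<gamma> s) (velocity_on A a b \<gamma> s))" by simp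
  qed
  then show ?case using piece by (intro Henstock_Kurzweil_Integration.integrable_combine[of 0 a b]) auto
next
  case start
  show ?case using integrable_on_refl[of "speed \<gamma>" 0] by (simp only: cbox_interval)
qed

text \<open>
  If \<open>\<beta>\<close> runs through \<open>\<gamma>\<close> on \<open>{a..b}\<close> at \<open>k\<close> times the pace, its speed is multiplied by \<open>k\<close> and the
  interval shrinks by the same factor. The exceptional set collects the ends and the preimages of the
  points where \<open>\<gamma>\<close> is not differentiable.
\<close>

lemma length_reparametrized:
  assumes \<gamma>: "piecewise_C1_curve A \<gamma>" and \<beta>: "continuous_on {0..1} \<beta>"
    and k: "k > 0" and ab: "0 \<le> a" "b \<le> 1" "k * a + m = 0" "k * b + m = 1"
    and eq: "\<And>s. s \<in> {a..b} \<Longrightarrow> \<beta> s = \<gamma> (k * s + m)"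
  shows "(speed \<beta> has_integral curve_length A g \<gamma>) {a..b}"
proof -
  obtain F where F: "finite F" "\<And>s c. s \<in> {0<..<1} - F \<Longrightarrow> c \<in> A \<Longrightarrow> \<gamma> s \<in> chart_dom c \<Longrightarrow>
      (chart_map c \<circ> \<gamma>) differentiable (at s)"
    using piecewise_C1_curve_differentiable[OF \<gamma>] by metis
  have "(speed \<gamma> has_integral curve_length A g \<gamma>) (cbox 0 1)"
    unfolding curve_length_def using speed_integrable[OF \<gamma>] by (simp add: integrable_integral)
  then have "((\<lambda>s. speed \<gamma> (k * s + m)) has_integral curve_length A g \<gamma> / k) {a..b}"
  proof -
    have "(0 - m) /\<^sub>R k = a" "(1 - m) /\<^sub>R k = b" using k ab by (auto simp: field_simps)
    with has_integral_affinity'[OF \<open>(speed \<gamma> has_integral _) (cbox 0 1)\<close> k, of m] show ?thesis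
      by (simp add: field_simps)
  qed
  from has_integral_mult_right[OF this, of k] k
  have int: "((\<lambda>s. k * speed \<gamma> (k * s + m)) has_integral curve_length A g \<gamma>) {a..b}" by simp
  let ?F = "{a, b} \<union> (\<lambda>u. (u - m) / k) ` F"
  show ?thesis
  proof (rule has_integral_spike_finite[OF _ _ int])
    show "finite ?F" using F(1) by simp
    fix s assume s: "s \<in> {a..b} - ?F"
    then have sab: "a < s" "s < b" by auto
    let ?u = "k * s + m"
    have "k * a < k * s" "k * s < k * b" using sab k by auto
    then have u01: "0 < ?u" "?u < 1" using ab by linarith+
    have "?u \<notin> F"
    proof
      assume "?u \<in> F"
      then have "(?u - m) / k \<in> (\<lambda>u. (u - m) / k) ` F" by (rule imageI)
      moreover have "(?u - m) / k = s" using k by simp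
      ultimately show False using s by simp
    qed
    obtain c where c: "c \<in> A" "\<gamma> ?u \<in> chart_dom c" by (rule chart_around)
    have "(chart_map c \<circ> \<gamma>) differentiable (at ?u)"
      using F(2) u01 \<open>?u \<notin> F\<close> c by auto
    then obtain D where D: "((chart_map c \<circ> \<gamma>) has_vector_derivative D) (at ?u)"
      using vector_derivative_works by blast
    have "((\<lambda>s. k * s + m) has_vector_derivative k) (at s)"
      by (auto intro!: derivative_eq_intros)
    from vector_diff_chain_at[OF this D]
    have "((chart_map c \<circ> \<beta>) has_vector_derivative k *\<^sub>R D) (at s)"
      by (rule has_vector_derivative_transform_within_open[where S = "{a<..<b}"])
        (use sab eq in auto)
    moreover have "\<beta> s = \<gamma> ?u" using eq sab by simp
    ultimately have "speed \<beta> s = form_norm (G c (\<gamma> ?u)) (k *\<^sub>R D)"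
      using speed_eq_form_norm[of s \<beta> c "k *\<^sub>R D"] sab ab \<beta> c by simp
    moreover have "speed \<gamma> ?u = form_norm (G c (\<gamma> ?u)) D"
      using u01 by (intro speed_eq_form_norm c D piecewise_C1_curve_continuous[OF \<gamma>]) simp
    ultimately show "speed \<beta> s = k * speed \<gamma> ?u"
      using k by (simp add: form_norm_scaleR)
  qed
qed

end

section \<open>Triangle inequality for the geodesic distance\<close>

text \<open>
  Only the values of the curve on the interval matter, so \<open>\<beta>\<close> may be arbitrary elsewhere. This allows
  applying the lemma to both halves of a concatenated curve.
\<close>

lemma C1_curve_on_affine:
  assumes \<gamma>: "C1_curve_on A \<gamma> (k * a + m) (k * b + m)" and k: "k > 0"
    and eq: "\<And>s. s \<in> {a..b} \<Longrightarrow> \<beta> s = \<gamma> (k * s + m)"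
  shows "C1_curve_on A \<beta> a b"
proof -
  let ?I = "{k * a + m..k * b + m}"
  have im: "k * s + m \<in> ?I" if "s \<in> {a..b}" for s using that k by auto
  have cont: "continuous_on ?I \<gamma>"
    and deriv: "\<And>c. c \<in> A \<Longrightarrow> \<exists>D. continuous_on {s\<in>?I. \<gamma> s \<in> chart_dom c} D \<and>
        (\<forall>s\<in>?I. \<gamma> s \<in> chart_dom c \<longrightarrow>
           ((chart_map c \<circ> \<gamma>) has_vector_derivative D s) (at s within ?I))"
    using \<gamma> unfolding C1_curve_on_def by blast+
  have "continuous_on {a..b} (\<lambda>s. \<gamma> (k * s + m))"
    by (rule continuous_on_compose2[OF cont]) (use im in \<open>auto intro!: continuous_intros\<close>)
  then have 1: "continuous_on {a..b} \<beta>" by (rule continuous_on_eq) (simp add: eq)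
  have 2: "\<exists>D. continuous_on {s\<in>{a..b}. \<beta> s \<in> chart_dom c} D \<and>
      (\<forall>s\<in>{a..b}. \<beta> s \<in> chart_dom c \<longrightarrow>
         ((chart_map c \<circ> \<beta>) has_vector_derivative D s) (at s within {a..b}))" if c: "c \<in> A" for c
  proof -
    obtain D where D: "continuous_on {s\<in>?I. \<gamma> s \<in> chart_dom c} D"
      "\<And>s. s \<in> ?I \<Longrightarrow> \<gamma> s \<in> chart_dom c \<Longrightarrow>
        ((chart_map c \<circ> \<gamma>) has_vector_derivative D s) (at s within ?I)"
      using deriv[OF c] by blast
    show ?thesis
    proof (intro exI[of _ "\<lambda>s. k *\<^sub>R D (k * s + m)"] conjI ballI impI)
      show "continuous_on {s\<in>{a..b}. \<beta> s \<in> chart_dom c} (\<lambda>s. k *\<^sub>R D (k * s + m))"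
        by (intro continuous_intros continuous_on_compose2[OF D(1)])
          (use im eq in \<open>auto intro!: continuous_intros\<close>)
      fix s assume s: "s \<in> {a..b}" "\<beta> s \<in> chart_dom c"
      have "((\<lambda>s. k * s + m) has_vector_derivative k) (at s within {a..b})"
        by (auto intro!: derivative_eq_intros)
      moreover have "((chart_map c \<circ> \<gamma>) has_vector_derivative D (k * s + m))
          (at (k * s + m) within (\<lambda>s. k * s + m) ` {a..b})"
        by (rule has_vector_derivative_within_subset[OF D(2)]) (use s im eq in auto)
      ultimately have "(((chart_map c \<circ> \<gamma>) \<circ> (\<lambda>s. k * s + m)) has_vector_derivative k *\<^sub>R D (k * s + m))
          (at s within {a..b})"
        by (rule vector_diff_chain_within)
      then show "((chart_map c \<circ> \<beta>) has_vector_derivative k *\<^sub>R D (k * s + m)) (at s within {a..b})"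
        by (rule has_vector_derivative_transform[OF s(1), rotated]) (simp add: eq)
    qed
  qed
  show ?thesis using 1 2 unfolding C1_curve_on_def by blast
qed

lemma piecewise_C1_curve_joinpaths:
  assumes \<gamma>1: "piecewise_C1_curve A \<gamma>1" and \<gamma>2: "piecewise_C1_curve A \<gamma>2"
    and join: "\<gamma>1 1 = \<gamma>2 0"
  shows "piecewise_C1_curve A (\<gamma>1 +++ \<gamma>2)"
proof -
  obtain n1 \<tau>1 where \<tau>1: "\<tau>1 0 = 0" "\<tau>1 n1 = 1" "\<And>i. i \<le> n1 \<Longrightarrow> 0 \<le> \<tau>1 i \<and> \<tau>1 i \<le> 1"
    and step1: "\<And>i. i < n1 \<Longrightarrow> \<tau>1 i < \<tau>1 (Suc i) \<and> C1_curve_on A \<gamma>1 (\<tau>1 i) (\<tau>1 (Suc i))"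
    by (rule piecewise_C1_curveE[OF \<gamma>1]) blast
  obtain n2 \<tau>2 where \<tau>2: "\<tau>2 0 = 0" "\<tau>2 n2 = 1" "\<And>i. i \<le> n2 \<Longrightarrow> 0 \<le> \<tau>2 i \<and> \<tau>2 i \<le> 1"
    and step2: "\<And>i. i < n2 \<Longrightarrow> \<tau>2 i < \<tau>2 (Suc i) \<and> C1_curve_on A \<gamma>2 (\<tau>2 i) (\<tau>2 (Suc i))"
    by (rule piecewise_C1_curveE[OF \<gamma>2]) blast
  let ?\<gamma> = "\<gamma>1 +++ \<gamma>2"
  define \<tau> where "\<tau> i = (if i \<le> n1 then \<tau>1 i / 2 else (\<tau>2 (i - n1) + 1) / 2)" for i
  have \<tau>_ge: "\<tau> (n1 + j) = (\<tau>2 j + 1) / 2" for j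
    using \<tau>1(2) \<tau>2(1) by (cases j) (auto simp: \<tau>_def)
  have left: "\<tau> i < \<tau> (Suc i) \<and> C1_curve_on A ?\<gamma> (\<tau> i) (\<tau> (Suc i))" if i: "i < n1" for i
  proof -
    have \<tau>: "\<tau> i = \<tau>1 i / 2" "\<tau> (Suc i) = \<tau>1 (Suc i) / 2" using i by (auto simp: \<tau>_def)
    have "C1_curve_on A ?\<gamma> (\<tau> i) (\<tau> (Suc i))"
    proof (rule C1_curve_on_affine[where k = 2 and m = 0])
      show "C1_curve_on A \<gamma>1 (2 * \<tau> i + 0) (2 * \<tau> (Suc i) + 0)" using step1[OF i] unfolding \<tau> by simp
      fix s assume "s \<in> {\<tau> i..\<tau> (Suc i)}"
      then have "s \<le> 1 / 2" using \<tau>1(3)[of "Suc i"] i \<tau> by auto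
      then show "?\<gamma> s = \<gamma>1 (2 * s + 0)" by (simp add: joinpaths_def)
    qed simp
    then show ?thesis using step1[OF i] unfolding \<tau> by simp
  qed
  have right: "\<tau> (n1 + j) < \<tau> (Suc (n1 + j)) \<and> C1_curve_on A ?\<gamma> (\<tau> (n1 + j)) (\<tau> (Suc (n1 + j)))"
    if j: "j < n2" for j
  proof -
    have \<tau>: "\<tau> (n1 + j) = (\<tau>2 j + 1) / 2" "\<tau> (Suc (n1 + j)) = (\<tau>2 (Suc j) + 1) / 2"
      using \<tau>_ge[of j] \<tau>_ge[of "Suc j"] by auto
    have "C1_curve_on A ?\<gamma> (\<tau> (n1 + j)) (\<tau> (Suc (n1 + j)))"
    proof (rule C1_curve_on_affine[where k = 2 and m = "-1"])
      show "C1_curve_on A \<gamma>2 (2 * \<tau> (n1 + j) + - 1) (2 * \<tau> (Suc (n1 + j)) + - 1)"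
      proof -
        have "2 * \<tau> (n1 + j) + - 1 = \<tau>2 j" "2 * \<tau> (Suc (n1 + j)) + - 1 = \<tau>2 (Suc j)"
          unfolding \<tau> by (simp_all add: add_divide_distrib)
        then show ?thesis using step2[OF j] by (simp only:)
      qed
      fix s assume "s \<in> {\<tau> (n1 + j)..\<tau> (Suc (n1 + j))}"
      then have "s \<ge> 1 / 2" using \<tau>2(3)[of j] j \<tau> by auto
      then show "?\<gamma> s = \<gamma>2 (2 * s + - 1)"
      proof (cases "s = 1 / 2")
        case True
        then show ?thesis unfolding True joinpaths_def using join by simp
      qed (simp add: joinpaths_def)
    qed simp
    then show ?thesis using step2[OF j] unfolding \<tau> by simp
  qed
  show ?thesis
    unfolding piecewise_C1_curve_def
  proof (intro exI[of _ "n1 + n2"] exI[of _ \<tau>] conjI allI impI)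
    show "\<tau> 0 = 0" "\<tau> (n1 + n2) = 1" using \<tau>1(1) \<tau>2(2) \<tau>_ge[of n2] by (auto simp: \<tau>_def)
    fix i assume i: "i < n1 + n2"
    have "\<tau> i < \<tau> (Suc i) \<and> C1_curve_on A ?\<gamma> (\<tau> i) (\<tau> (Suc i))"
      using left[of i] right[of "i - n1"] i by (cases "i < n1") auto
    then show "\<tau> i < \<tau> (Suc i)" "C1_curve_on A ?\<gamma> (\<tau> i) (\<tau> (Suc i))" by blast+
  qed
qed

lemma ennreal_add_le: "ennreal (a + b) \<le> ennreal a + ennreal b"
proof (cases "0 \<le> a \<and> 0 \<le> b")
  case False
  then have "a + b \<le> max a b" by auto
  then have "ennreal (a + b) \<le> ennreal (max a b)" by (rule ennreal_leI)
  also have "\<dots> \<le> ennreal a + ennreal b" by (auto simp: max_def)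
  finally show ?thesis .
qed (simp add: ennreal_plus)

lemma geodesic_dist_le:
  assumes "piecewise_C1_curve A \<gamma>" "\<gamma> 0 = x" "\<gamma> 1 = y"
  shows "geodesic_dist A g x y \<le> ennreal (curve_length A g \<gamma>)"
  unfolding geodesic_dist_def using assms by (intro INF_lower) auto

context continuous_metric
begin

lemma curve_length_joinpaths:
  assumes \<gamma>1: "piecewise_C1_curve A \<gamma>1" and \<gamma>2: "piecewise_C1_curve A \<gamma>2"
    and join: "\<gamma>1 1 = \<gamma>2 0"
  shows "curve_length A g (\<gamma>1 +++ \<gamma>2) = curve_length A g \<gamma>1 + curve_length A g \<gamma>2"
proof -
  let ?\<gamma> = "\<gamma>1 +++ \<gamma>2"
  have cont: "continuous_on {0..1} ?\<gamma>"
    by (rule piecewise_C1_curve_continuous[OF piecewise_C1_curve_joinpaths[OF assms]])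
  have 1: "(speed ?\<gamma> has_integral curve_length A g \<gamma>1) {0..1/2}"
    by (rule length_reparametrized[OF \<gamma>1 cont, where k = 2 and m = 0]) (auto simp: joinpaths_def)
  have "?\<gamma> s = \<gamma>2 (2 * s + - 1)" if "s \<in> {1/2..1}" for s
  proof (cases "s = 1 / 2")
    case True
    then show ?thesis unfolding True joinpaths_def using join by simp
  qed (use that in \<open>simp add: joinpaths_def\<close>)
  then have 2: "(speed ?\<gamma> has_integral curve_length A g \<gamma>2) {1/2..1}"
    by (intro length_reparametrized[OF \<gamma>2 cont, where k = 2 and m = "-1"]) auto
  have "(speed ?\<gamma> has_integral (curve_length A g \<gamma>1 + curve_length A g \<gamma>2)) {0..1}"
    by (rule has_integral_combine[OF _ _ 1 2]) auto
  then show ?thesis unfolding curve_length_def[of A g ?\<gamma>] by (rule integral_unique)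
qed

text \<open>
  Concatenate two curves whose lengths are almost minimal.
\<close>

lemma geodesic_dist_triangle:
  "geodesic_dist A g x z \<le> geodesic_dist A g x y + geodesic_dist A g y z"
proof (cases "geodesic_dist A g x y = \<infinity> \<or> geodesic_dist A g y z = \<infinity>")
  case True
  then show ?thesis by auto
next
  case False
  have approx: "\<exists>\<gamma>. piecewise_C1_curve A \<gamma> \<and> \<gamma> 0 = u \<and> \<gamma> 1 = v \<and>
      ennreal (curve_length A g \<gamma>) < geodesic_dist A g u v + ennreal e"
    if "geodesic_dist A g u v \<noteq> \<infinity>" "e > 0" for u v e
  proof -
    have "geodesic_dist A g u v < geodesic_dist A g u v + ennreal e"
      using that by (simp add: ennreal_add_left_cancel_less less_top)
    then show ?thesis
      unfolding geodesic_dist_def[of A g u v] INF_less_iff by auto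
  qed
  show ?thesis
  proof (rule ennreal_le_epsilon)
    fix e :: real assume e: "e > 0"
    obtain \<gamma>1 where \<gamma>1: "piecewise_C1_curve A \<gamma>1" "\<gamma>1 0 = x" "\<gamma>1 1 = y"
      "ennreal (curve_length A g \<gamma>1) < geodesic_dist A g x y + ennreal (e / 2)"
      using approx[of x y "e / 2"] False e by auto
    obtain \<gamma>2 where \<gamma>2: "piecewise_C1_curve A \<gamma>2" "\<gamma>2 0 = y" "\<gamma>2 1 = z"
      "ennreal (curve_length A g \<gamma>2) < geodesic_dist A g y z + ennreal (e / 2)"
      using approx[of y z "e / 2"] False e by auto
    have "geodesic_dist A g x z \<le> ennreal (curve_length A g (\<gamma>1 +++ \<gamma>2))"
      using \<gamma>1 \<gamma>2 by (intro geodesic_dist_le piecewise_C1_curve_joinpaths) (auto simp: joinpaths_def)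
    also have "\<dots> \<le> ennreal (curve_length A g \<gamma>1) + ennreal (curve_length A g \<gamma>2)"
      using \<gamma>1 \<gamma>2 by (simp add: curve_length_joinpaths ennreal_add_le)
    also have "\<dots> \<le> (geodesic_dist A g x y + ennreal (e / 2)) + (geodesic_dist A g y z + ennreal (e / 2))"
      using \<gamma>1(4) \<gamma>2(4) by (intro add_mono less_imp_le)
    also have "\<dots> = geodesic_dist A g x y + geodesic_dist A g y z + (ennreal (e / 2) + ennreal (e / 2))"
      by (simp only: ac_simps)
    also have "ennreal (e / 2) + ennreal (e / 2) = ennreal e"
      using e by (simp flip: ennreal_plus)
    finally show "geodesic_dist A g x z \<le> geodesic_dist A g x y + geodesic_dist A g y z + ennreal e" .
  qed
qed

end

section \<open>The geodesic distance near a point\<close>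

text \<open>
  A curve that starts in \<open>U\<close> either stays there up to time 1, or there is a first time \<open>s0\<close> at which it
  is outside \<open>U\<close>. Until then it runs in \<open>U\<close>, and by closedness it is still in \<open>K\<close> at time \<open>s0\<close>, where
  \<open>h\<close> is at least as large as at the end point of the curve.
\<close>

lemma curve_reaches_level:
  fixes \<gamma> :: "real \<Rightarrow> 'a::topological_space"
  assumes \<gamma>: "continuous_on {0..1} \<gamma>" and K: "closed K" and U: "open U" "U \<subseteq> K" and start: "\<gamma> 0 \<in> U"
    and h: "\<And>y. y \<in> K - U \<Longrightarrow> h (\<gamma> 1) \<le> (h y :: real)"
  obtains s0 where "s0 \<in> {0..1}" "\<And>s. s \<in> {0..s0} \<Longrightarrow> \<gamma> s \<in> K" "h (\<gamma> 1) \<le> h (\<gamma> s0)"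
proof (cases "\<forall>s\<in>{0..1}. \<gamma> s \<in> U")
  case True
  then show ?thesis using U(2) by (intro that[of 1]) auto
next
  case False
  define S where "S = {s\<in>{0..1}. \<gamma> s \<in> - U}"
  have "closed S"
    unfolding S_def using continuous_closed_preimage[OF \<gamma>, of "- U"] U(1)
    by (simp add: Int_def vimage_def closed_Compl)
  moreover have bdd: "bdd_below S" "S \<noteq> {}" using False by (auto simp: S_def intro: bdd_belowI[of _ 0])
  ultimately have "Inf S \<in> S" by (intro closed_contains_Inf)
  define s0 where "s0 = Inf S"
  have s0: "s0 \<in> {0..1}" "\<gamma> s0 \<notin> U" using \<open>Inf S \<in> S\<close> by (auto simp: S_def s0_def)
  have before: "\<gamma> s \<in> U" if "0 \<le> s" "s < s0" for s
  proof (rule ccontr)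
    assume "\<gamma> s \<notin> U"
    then have "s \<in> S" using that s0 by (auto simp: S_def)
    then have "s0 \<le> s" unfolding s0_def by (rule cInf_lower[OF _ bdd(1)])
    then show False using that by simp
  qed
  have "s0 \<noteq> 0" using start s0 by auto
  then have pos: "0 < s0" using s0 by auto
  have K0: "\<gamma> s \<in> K" if "s \<in> {0..s0}" for s
  proof -
    have cl: "closure {0..<s0} = {0..s0}" using pos by simp
    have "\<gamma> ` closure {0..<s0} \<subseteq> K"
    proof (rule image_closure_subset[OF _ K])
      show "continuous_on (closure {0..<s0}) \<gamma>"
        unfolding cl by (rule continuous_on_subset[OF \<gamma>]) (use s0 in auto)
      show "\<gamma> ` {0..<s0} \<subseteq> K" using before U(2) by auto
    qed
    then show ?thesis using that unfolding cl by blast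
  qed
  show ?thesis
  proof (rule that[OF s0(1) K0])
    show "h (\<gamma> 1) \<le> h (\<gamma> s0)" using K0[of s0] pos s0(2) by (intro h) auto
  qed
qed

context continuous_metric
begin

lemma speed_nonneg:
  assumes s: "s \<in> {0<..<1}" and \<gamma>: "continuous_on {0..1} \<gamma>"
    and diff: "\<And>c. c \<in> A \<Longrightarrow> \<gamma> s \<in> chart_dom c \<Longrightarrow> (chart_map c \<circ> \<gamma>) differentiable (at s)"
  shows "0 \<le> speed \<gamma> s"
proof -
  obtain c where c: "c \<in> A" "\<gamma> s \<in> chart_dom c" by (rule chart_around)
  then have D: "((chart_map c \<circ> \<gamma>) has_vector_derivative vector_derivative (chart_map c \<circ> \<gamma>) (at s)) (at s)"
    using diff vector_derivative_works by blast
  show ?thesis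
    unfolding speed_eq_form_norm[OF s \<gamma> c D] form_norm_def
    using metric_matrix_pos[OF c] by (cases "vector_derivative (chart_map c \<circ> \<gamma>) (at s) = 0") (auto intro: less_imp_le)
qed

text \<open>
  The coordinate segment is a \<open>C\<^sup>1\<close> curve with constant velocity \<open>z' - z\<close> in the chart \<open>c\<close>.
\<close>

lemma geodesic_dist_le_segment:
  assumes c: "c \<in> A" and seg: "closed_segment z z' \<subseteq> chart_image c"
    and B: "\<And>u. u \<in> closed_segment z z' \<Longrightarrow> form_norm (G c (chart_inv c u)) (z' - z) \<le> B"
  shows "geodesic_dist A g (chart_inv c z) (chart_inv c z') \<le> ennreal B"
proof -
  define w where "w = z' - z"
  let ?l = "\<lambda>s. z + s *\<^sub>R w"
  let ?\<gamma> = "\<lambda>s. chart_inv c (?l s)"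
  have l: "?l s \<in> closed_segment z z'" if "s \<in> {0..1}" for s
    using that unfolding in_segment w_def by (intro exI[of _ s]) (auto simp: algebra_simps)
  have li: "?l s \<in> chart_image c" if "s \<in> {0..1}" for s
    using l[OF that] seg by blast
  have lder: "(?l has_vector_derivative w) (at s within S)" for s S
    by (auto intro!: derivative_eq_intros)
  have cont: "continuous_on {0..1} ?\<gamma>"
    by (rule continuous_on_compose2[OF continuous_chart_inv[OF c]]) (use li in \<open>auto intro!: continuous_intros\<close>)
  have C1: "C1_curve_on A ?\<gamma> 0 1"
    unfolding C1_curve_on_def
  proof (intro conjI cont ballI)
    fix c' assume c': "c' \<in> A"
    let ?D = "\<lambda>s. frechet_derivative (transition c c') (at (?l s)) w"
    have mem: "?l s \<in> chart_map c ` (chart_dom c \<inter> chart_dom c')" if "s \<in> {0..1}" "?\<gamma> s \<in> chart_dom c'" for s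
      using that li[OF that(1)] c by (auto intro!: image_eqI[of _ _ "?\<gamma> s"] simp: chart_map_inv chart_inv_in_dom)
    show "\<exists>D. continuous_on {s\<in>{0..1}. ?\<gamma> s \<in> chart_dom c'} D \<and>
        (\<forall>s\<in>{0..1}. ?\<gamma> s \<in> chart_dom c' \<longrightarrow>
           ((chart_map c' \<circ> ?\<gamma>) has_vector_derivative D s) (at s within {0..1}))"
    proof (intro exI[of _ ?D] conjI ballI impI)
      show "continuous_on {s\<in>{0..1}. ?\<gamma> s \<in> chart_dom c'} ?D"
        by (rule continuous_on_compose2[OF continuous_on_transition_derivative[OF c c']])
          (use mem in \<open>auto intro!: continuous_intros\<close>)
      fix s :: real assume s: "s \<in> {0..1}" "?\<gamma> s \<in> chart_dom c'"
      have "(transition c c' has_derivative frechet_derivative (transition c c') (at (?l s))) (at (?l s))"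
        using transition_has_derivative[OF c c' chart_inv_in_dom[OF c li[OF s(1)]] s(2)]
        by (simp add: chart_map_inv[OF c li[OF s(1)]])
      from vector_derivative_diff_chain_within[OF lder has_derivative_at_withinI[OF this]]
      show "((chart_map c' \<circ> ?\<gamma>) has_vector_derivative ?D s) (at s within {0..1})"
        by (simp add: transition_def o_def)
    qed
  qed
  then have pw: "piecewise_C1_curve A ?\<gamma>"
    unfolding piecewise_C1_curve_def by (intro exI[of _ 1] exI[of _ real]) auto
  have speed: "speed ?\<gamma> s \<le> B" if s: "s \<in> {0<..<1}" for s
  proof -
    have "((chart_map c \<circ> ?\<gamma>) has_vector_derivative w) (at s)"
      by (rule has_vector_derivative_transform_within_open[OF lder, where S = "{0<..<1}"])
        (use s li c in \<open>auto simp: chart_map_inv\<close>)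
    moreover have "?\<gamma> s \<in> chart_dom c" using s li c by (auto intro: chart_inv_in_dom)
    ultimately have "speed ?\<gamma> s = form_norm (G c (?\<gamma> s)) w" by (intro speed_eq_form_norm s cont c)
    then show ?thesis using B[OF l[of s]] s by (simp add: w_def)
  qed
  have "curve_length A g ?\<gamma> \<le> B"
  proof -
    let ?f = "\<lambda>s. if s \<in> {0, 1} then B else speed ?\<gamma> s"
    have "(?f has_integral curve_length A g ?\<gamma>) {0..1}"
      unfolding curve_length_def
      by (rule has_integral_spike_finite[OF _ _ integrable_integral[OF speed_integrable[OF pw]], of "{0, 1}"]) auto
    moreover have "((\<lambda>_. B) has_integral B) {0..1::real}"
      using has_integral_const_real[of B 0 1] by simp
    ultimately show ?thesis
      by (rule has_integral_le) (use speed in auto)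
  qed
  moreover have "geodesic_dist A g (chart_inv c z) (chart_inv c z') \<le> ennreal (curve_length A g ?\<gamma>)"
    using pw by (intro geodesic_dist_le) (auto simp: w_def)
  ultimately show ?thesis by (meson ennreal_leI order_trans)
qed

text \<open>
  As long as the metric along \<open>\<gamma>\<close> is at least \<open>1 - \<eta>\<close> times the constant metric \<open>Q = G c x\<close>, the length of
  \<open>\<gamma>\<close> is at least \<open>1 - \<eta>\<close> times the \<open>Q\<close>-length of its coordinate displacement \<open>w\<close>. To see that straight
  lines are shortest for \<open>Q\<close>, integrate the inequality between \<open>w \<bullet> (Q *v D)\<close> and the product of the
  \<open>Q\<close>-lengths of \<open>w\<close> and of the coordinate velocity \<open>D\<close>.
\<close>

lemma initial_length_lower_bound:
  assumes c: "c \<in> A" and x: "x \<in> chart_dom c"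
    and \<gamma>: "piecewise_C1_curve A \<gamma>" "\<gamma> 0 = x" and s0: "s0 \<in> {0..1}"
    and dom: "\<And>s. s \<in> {0..s0} \<Longrightarrow> \<gamma> s \<in> chart_dom c"
    and \<eta>: "\<eta> < 1"
    and close: "\<And>s u. s \<in> {0..s0} \<Longrightarrow> (1 - \<eta>) * form_norm (G c x) u \<le> form_norm (G c (\<gamma> s)) u"
  shows "(1 - \<eta>) * form_norm (G c x) (chart_map c (\<gamma> s0) - chart_map c x) \<le> curve_length A g \<gamma>"
proof -
  define Q where "Q = G c x"
  define w where "w = chart_map c (\<gamma> s0) - chart_map c x"
  have cont: "continuous_on {0..1} \<gamma>" by (rule piecewise_C1_curve_continuous[OF \<gamma>(1)])
  obtain F where F: "finite F" "\<And>s c. s \<in> {0<..<1} - F \<Longrightarrow> c \<in> A \<Longrightarrow> \<gamma> s \<in> chart_dom c \<Longrightarrow>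
      (chart_map c \<circ> \<gamma>) differentiable (at s)"
    using piecewise_C1_curve_differentiable[OF \<gamma>(1)] by metis
  \<comment> \<open>The absolute value makes the integrand nonnegative at the break points, where the velocity may be no tangent vector.\<close>
  let ?f = "\<lambda>s. \<bar>speed \<gamma> s\<bar>"
  have f: "(?f has_integral curve_length A g \<gamma>) {0..1}"
    unfolding curve_length_def
  proof (rule has_integral_spike_finite[OF _ _ integrable_integral[OF speed_integrable[OF \<gamma>(1)]]])
    show "finite ({0, 1} \<union> F)" using F(1) by simp
    show "?f s = speed \<gamma> s" if "s \<in> {0..1} - ({0, 1} \<union> F)" for s
      using that by (intro abs_of_nonneg speed_nonneg[OF _ cont F(2)]) auto
  qed
  have f_int: "?f integrable_on {0..s0}"
    using s0 by (intro integrable_subinterval_real[OF has_integral_integrable[OF f]]) auto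
  have part: "integral {0..s0} ?f \<le> curve_length A g \<gamma>"
  proof -
    have "integral {0..s0} ?f \<le> integral {0..1} ?f"
      using s0 by (intro integral_subset_le f_int has_integral_integrable[OF f]) auto
    then show ?thesis using integral_unique[OF f] by simp
  qed
  show ?thesis
  proof (cases "form_norm Q w = 0")
    case True
    have "0 \<le> integral {0..s0} ?f" by (intro integral_nonneg f_int) simp
    then show ?thesis using part True by (simp add: Q_def w_def)
  next
    case False
    have mn: "form_norm Q w > 0"
      using False metric_matrix_pos[OF c x, of w] by (cases "w = 0") (auto simp: form_norm_def Q_def)
    let ?y = "chart_map c \<circ> \<gamma>"
    let ?D = "\<lambda>s. vector_derivative ?y (at s)"
    let ?\<phi> = "\<lambda>u. w \<bullet> (Q *v u)"
    have bl: "bounded_linear ?\<phi>"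
      by (intro bounded_linear_inner_right_comp matrix_vector_mul_bounded_linear)
    have der: "(?y has_vector_derivative ?D s) (at s)" if "s \<in> {0<..<s0} - F" for s
      using F(2)[of s c] that s0 c dom vector_derivative_works by auto
    have "((\<lambda>s. ?\<phi> (?D s)) has_integral (?\<phi> (?y s0) - ?\<phi> (?y 0))) {0..s0}"
    proof (rule fundamental_theorem_of_calculus_interior_strong[OF F(1)])
      show "0 \<le> s0" using s0 by simp
      show "((\<lambda>s. ?\<phi> (?y s)) has_vector_derivative ?\<phi> (?D s)) (at s)" if "s \<in> {0<..<s0} - F" for s
        by (rule bounded_linear.has_vector_derivative[OF bl der[OF that]])
      have "continuous_on {0..s0} (\<lambda>s. chart_map c (\<gamma> s))"
        by (rule continuous_on_compose2[OF continuous_chart_map[OF c] continuous_on_subset[OF cont]])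
          (use s0 dom in auto)
      then show "continuous_on {0..s0} (\<lambda>s. ?\<phi> (?y s))"
        by (intro bounded_linear.continuous_on[OF bl]) (simp add: o_def)
    qed
    moreover have "?\<phi> (?y s0) - ?\<phi> (?y 0) = (form_norm Q w)\<^sup>2"
    proof -
      have "?\<phi> (?y s0) - ?\<phi> (?y 0) = ?\<phi> w"
        by (simp add: w_def \<gamma>(2) matrix_vector_mult_diff_distrib inner_diff_right)
      moreover have "0 \<le> ?\<phi> w" using mn by (simp add: form_norm_def)
      ultimately show ?thesis by (simp add: form_norm_def)
    qed
    ultimately have 1: "((\<lambda>s. ?\<phi> (?D s)) has_integral (form_norm Q w)\<^sup>2) {0..s0}" by simp
    let ?E = "{0, s0} \<union> F" and ?C = "form_norm Q w / (1 - \<eta>)"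
    have 2: "((\<lambda>s. if s \<in> ?E then 0 else ?\<phi> (?D s)) has_integral (form_norm Q w)\<^sup>2) {0..s0}"
      by (rule has_integral_spike_finite[OF _ _ 1, of ?E]) (auto simp: F(1))
    have 3: "((\<lambda>s. ?C * ?f s) has_integral ?C * integral {0..s0} ?f) {0..s0}"
      by (intro has_integral_mult_right integrable_integral f_int)
    have C: "0 \<le> ?C" using mn \<eta> by simp
    have "(form_norm Q w)\<^sup>2 \<le> ?C * integral {0..s0} ?f"
    proof (rule has_integral_le[OF 2 3])
      fix s assume s: "s \<in> {0..s0}"
      show "(if s \<in> ?E then 0 else ?\<phi> (?D s)) \<le> ?C * ?f s"
      proof (cases "s \<in> ?E")
        case True
        then show ?thesis using mult_nonneg_nonneg[OF C, of "?f s"] by simp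
      next
        case False
        then have s': "s \<in> {0<..<s0} - F" using s by auto
        have "?\<phi> (?D s) \<le> form_norm Q w * form_norm Q (?D s)"
          unfolding Q_def
          by (rule form_norm_Cauchy_Schwarz[OF metric_matrix_pos[OF c x] metric_matrix_symmetric[OF c x]])
        also have "\<dots> = ?C * ((1 - \<eta>) * form_norm Q (?D s))" using \<eta> by simp
        also have "\<dots> \<le> ?C * form_norm (G c (\<gamma> s)) (?D s)"
          using close[OF s] C unfolding Q_def by (intro mult_left_mono)
        also have "form_norm (G c (\<gamma> s)) (?D s) = speed \<gamma> s"
          using s' s0 by (intro speed_eq_form_norm[symmetric] cont c dom der) auto
        also have "?C * speed \<gamma> s \<le> ?C * ?f s" using C by (intro mult_left_mono) auto
        finally show ?thesis unfolding if_not_P[OF False] .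
      qed
    qed
    then have "form_norm Q w * ((1 - \<eta>) * form_norm Q w) \<le> form_norm Q w * integral {0..s0} ?f"
      using \<eta> by (simp add: power2_eq_square field_simps)
    then have "(1 - \<eta>) * form_norm Q w \<le> integral {0..s0} ?f"
      using mn by (simp only: mult_le_cancel_left_pos)
    then show ?thesis using part by (simp add: Q_def w_def)
  qed
qed

text \<open>
  Infinitesimally the geodesic distance is the norm of the metric at \<open>x\<close>. The upper bound uses
  coordinate segments inside a ball. For the lower bound, a curve from \<open>x\<close> to a nearby point is cut off
  when it leaves the ellipsoid \<open>?E\<close>, on which the metric is comparable to its value \<open>Q\<close> at \<open>x\<close>; up to that
  time its displacement is at least as long as the one to the end point.
\<close>

lemma geodesic_dist_local:
  assumes c: "c \<in> A" and x: "x \<in> chart_dom c" and \<eta>: "0 < \<eta>" "\<eta> < 1"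
  obtains r where "r > 0" "ball (chart_map c x) r \<subseteq> chart_image c"
    "\<And>z z'. z \<in> ball (chart_map c x) r \<Longrightarrow> z' \<in> ball (chart_map c x) r \<Longrightarrow>
      geodesic_dist A g (chart_inv c z) (chart_inv c z') \<le> ennreal ((1 + \<eta>) * form_norm (G c x) (z' - z))"
    "\<And>z. z \<in> ball (chart_map c x) r \<Longrightarrow>
      ennreal ((1 - \<eta>) * form_norm (G c x) (z - chart_map c x)) \<le> geodesic_dist A g x (chart_inv c z)"
proof -
  define z0 Q where "z0 = chart_map c x" and "Q = G c x"
  have z0: "z0 \<in> chart_image c" "chart_inv c z0 = x" using x c by (auto simp: z0_def chart_inv_map)
  obtain R where R: "R > 0" "ball z0 R \<subseteq> chart_image c"
    "\<And>z w. z \<in> ball z0 R \<Longrightarrow> (1 - \<eta>) * form_norm Q w \<le> form_norm (G c (chart_inv c z)) w"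
    "\<And>z w. z \<in> ball z0 R \<Longrightarrow> form_norm (G c (chart_inv c z)) w \<le> (1 + \<eta>) * form_norm Q w"
    using form_norm_close[OF continuous_metric_matrix[OF c] open_chart_image[OF c] z0(1) _ \<eta>]
      metric_matrix_pos[OF c x] unfolding z0(2) Q_def by metis
  obtain \<kappa> where \<kappa>: "\<kappa> > 0" "\<And>w. \<kappa> * (norm w)\<^sup>2 \<le> w \<bullet> (Q *v w)"
    using quadratic_form_lower_bound[OF metric_matrix_pos[OF c x]] unfolding Q_def by metis
  have \<kappa>': "sqrt \<kappa> * norm w \<le> form_norm Q w" for w
    using real_sqrt_le_mono[OF \<kappa>(2)[of w]] by (simp add: form_norm_def real_sqrt_mult)
  \<comment> \<open>With this radius the ellipsoid \<open>?E\<close> below lies in the ball of radius \<open>R / 2\<close>.\<close>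
  define \<rho> where "\<rho> = sqrt \<kappa> * (R / 2)"
  have \<rho>: "\<rho> > 0" using \<kappa> R by (simp add: \<rho>_def)
  let ?m = "\<lambda>z. form_norm Q (z - z0)"
  let ?E = "{z. ?m z \<le> \<rho>}" and ?O = "{z. ?m z < \<rho>}"
  have cont: "continuous_on S ?m" for S by (intro continuous_intros)
  have E: "?E \<subseteq> cball z0 (R / 2)"
  proof
    fix z assume "z \<in> ?E"
    then have "sqrt \<kappa> * norm (z - z0) \<le> sqrt \<kappa> * (R / 2)" using \<kappa>'[of "z - z0"] by (simp add: \<rho>_def)
    then show "z \<in> cball z0 (R / 2)" using \<kappa> by (simp add: dist_norm norm_minus_commute)
  qed
  then have EV: "?E \<subseteq> ball z0 R" using R(1) by (auto simp: subset_iff)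
  have "compact ?E"
    unfolding compact_eq_bounded_closed
    using bounded_subset[OF bounded_cball E] closed_Collect_le[OF cont continuous_on_const] by blast
  have "open ?O" by (rule open_Collect_less[OF cont continuous_on_const])
  moreover have "z0 \<in> ?O" using \<rho> by (simp add: form_norm_def)
  ultimately obtain r where r: "r > 0" "ball z0 r \<subseteq> ?O" using openE by blast
  have rV: "ball z0 r \<subseteq> ball z0 R" using r(2) EV by force
  let ?K = "chart_inv c ` ?E" and ?U = "chart_inv c ` ?O"
  have OE: "?O \<subseteq> ?E" by auto
  have Ei: "?E \<subseteq> chart_image c" using EV R(2) by blast
  have "compact ?K"
    using \<open>compact ?E\<close> continuous_on_subset[OF continuous_chart_inv[OF c] Ei]
    by (rule compact_continuous_image[rotated])
  then have K: "closed ?K" by (rule compact_imp_closed)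
  have U: "open ?U" using \<open>open ?O\<close> OE Ei by (intro open_chart_inv_image c) auto
  show ?thesis
  proof (rule that[OF r(1), folded z0_def Q_def])
    show "ball z0 r \<subseteq> chart_image c" using rV R(2) by blast
    fix z assume z: "z \<in> ball z0 r"
    show "geodesic_dist A g (chart_inv c z) (chart_inv c z') \<le> ennreal ((1 + \<eta>) * form_norm Q (z' - z))"
      if z': "z' \<in> ball z0 r" for z'
    proof (rule geodesic_dist_le_segment[OF c])
      have "closed_segment z z' \<subseteq> ball z0 r" using z z' by (intro closed_segment_subset convex_ball)
      then have seg: "closed_segment z z' \<subseteq> ball z0 R" using rV by blast
      then show "closed_segment z z' \<subseteq> chart_image c" using R(2) by blast
      show "form_norm (G c (chart_inv c u)) (z' - z) \<le> (1 + \<eta>) * form_norm Q (z' - z)"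
        if "u \<in> closed_segment z z'" for u
        using seg that by (intro R(4)) blast
    qed
    show "ennreal ((1 - \<eta>) * form_norm Q (z - z0)) \<le> geodesic_dist A g x (chart_inv c z)"
      unfolding geodesic_dist_def
    proof (intro INF_greatest ennreal_leI)
      fix \<gamma> assume "\<gamma> \<in> {\<gamma>. piecewise_C1_curve A \<gamma> \<and> \<gamma> 0 = x \<and> \<gamma> 1 = chart_inv c z}"
      then have \<gamma>: "piecewise_C1_curve A \<gamma>" "\<gamma> 0 = x" "\<gamma> 1 = chart_inv c z" by auto
      let ?h = "\<lambda>y. ?m (chart_map c y)"
      have zO: "z \<in> ?O" using z r(2) by blast
      then have h1: "?h (\<gamma> 1) = ?m z" using OE Ei \<gamma>(3) by (subst \<gamma>(3), subst chart_map_inv[OF c]) auto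
      have "?h (\<gamma> 1) \<le> ?h y" if y: "y \<in> ?K - ?U" for y
      proof -
        obtain u where "u \<in> ?E" "y = chart_inv c u" "u \<notin> ?O" using y by blast
        then have "?h y = \<rho>" using Ei chart_map_inv[OF c, of u] by auto
        then show ?thesis unfolding h1 using zO by simp
      qed
      moreover have "\<gamma> 0 \<in> ?U" using \<gamma>(2) z0(2) \<open>z0 \<in> ?O\<close> by (metis image_eqI)
      ultimately obtain s0 where s0: "s0 \<in> {0..1}" "\<And>s. s \<in> {0..s0} \<Longrightarrow> \<gamma> s \<in> ?K" "?h (\<gamma> 1) \<le> ?h (\<gamma> s0)"
        using curve_reaches_level[OF piecewise_C1_curve_continuous[OF \<gamma>(1)] K U, of ?h] OE by (metis image_mono)
      have mem: "\<gamma> s \<in> chart_dom c \<and> chart_inv c (chart_map c (\<gamma> s)) = \<gamma> s \<and> chart_map c (\<gamma> s) \<in> ball z0 R"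
        if "s \<in> {0..s0}" for s
      proof -
        from s0(2)[OF that] obtain u where "u \<in> ?E" "\<gamma> s = chart_inv c u" by blast
        moreover from this have "u \<in> chart_image c" "u \<in> ball z0 R" using Ei EV by blast+
        ultimately show ?thesis by (simp add: chart_map_inv[OF c] chart_inv_in_dom[OF c])
      qed
      have "(1 - \<eta>) * ?m z \<le> (1 - \<eta>) * ?h (\<gamma> s0)"
        using s0(3) \<eta> unfolding h1 by (intro mult_left_mono) auto
      also have "\<dots> \<le> curve_length A g \<gamma>"
        unfolding z0_def Q_def
      proof (rule initial_length_lower_bound[OF c x \<gamma>(1,2) s0(1) _ \<eta>(2)])
        show "\<gamma> s \<in> chart_dom c" if "s \<in> {0..s0}" for s using mem[OF that] by blast
        show "(1 - \<eta>) * form_norm (G c x) u \<le> form_norm (G c (\<gamma> s)) u" if "s \<in> {0..s0}" for s u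
          using R(3)[of "chart_map c (\<gamma> s)" u] mem[OF that] by (simp add: Q_def)
      qed
      finally show "(1 - \<eta>) * ?m z \<le> curve_length A g \<gamma>" .
    qed
  qed
qed

end

text \<open>
  Compare the lower bound for the first distance with the upper bound for the second one at the point
  \<open>z0 + s *\<^sub>R w\<close>, divide by \<open>s\<close>, and let the error \<open>\<eta>\<close> tend to 0.
\<close>

lemma form_norm_le_of_geodesic_dist_eq:
  assumes "continuous_metric A g" "continuous_metric A h"
    and c: "c \<in> A" and x: "x \<in> chart_dom c"
    and r: "r > 0" and eq: "\<And>z. z \<in> ball (chart_map c x) r \<Longrightarrow>
      geodesic_dist A g x (chart_inv c z) = geodesic_dist A h x (chart_inv c z)"
  shows "form_norm (metric_matrix A g c x) w \<le> form_norm (metric_matrix A h c x) w"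
proof -
  interpret g: continuous_metric A g by fact
  interpret h: continuous_metric A h by fact
  define z0 where "z0 = chart_map c x"
  have z0: "chart_inv c z0 = x" using c x by (simp add: z0_def g.chart_inv_map)
  let ?mg = "form_norm (metric_matrix A g c x)" and ?mh = "form_norm (metric_matrix A h c x)"
  have "(1 - \<eta>) * ?mg w \<le> (1 + \<eta>) * ?mh w" if \<eta>: "0 < \<eta>" "\<eta> < 1" for \<eta>
  proof -
    obtain r1 where r1: "r1 > 0"
      "\<And>z. z \<in> ball z0 r1 \<Longrightarrow> ennreal ((1 - \<eta>) * ?mg (z - z0)) \<le> geodesic_dist A g x (chart_inv c z)"
      unfolding z0_def by (rule g.geodesic_dist_local[OF c x \<eta>]) blast
    obtain r2 where r2: "r2 > 0"
      "\<And>z z'. z \<in> ball z0 r2 \<Longrightarrow> z' \<in> ball z0 r2 \<Longrightarrow>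
        geodesic_dist A h (chart_inv c z) (chart_inv c z') \<le> ennreal ((1 + \<eta>) * ?mh (z' - z))"
      unfolding z0_def by (rule h.geodesic_dist_local[OF c x \<eta>]) blast
    \<comment> \<open>The shift by 1 in the denominator covers the case \<open>w = 0\<close>.\<close>
    define s where "s = min r (min r1 r2) / (2 * (norm w + 1))"
    have s: "s > 0" using r r1(1) r2(1) by (simp add: s_def add_nonneg_pos)
    define z where "z = z0 + s *\<^sub>R w"
    have "s * norm w < min r (min r1 r2)"
    proof -
      have "s * norm w \<le> s * (norm w + 1)" using s by simp
      also have "\<dots> = min r (min r1 r2) / 2"
      proof -
        have "norm w + 1 \<noteq> 0" using norm_ge_zero[of w] by linarith
        then show ?thesis unfolding s_def by (simp add: field_simps)
      qed
      also have "\<dots> < min r (min r1 r2)"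
        using r r1(1) r2(1) by linarith
      finally show ?thesis .
    qed
    then have z: "z \<in> ball z0 r" "z \<in> ball z0 r1" "z \<in> ball z0 r2"
      using s by (auto simp: z_def dist_norm)
    have "ennreal ((1 - \<eta>) * ?mg (z - z0)) \<le> geodesic_dist A h x (chart_inv c z)"
      using r1(2)[OF z(2)] eq[folded z0_def, OF z(1)] by simp
    also have "\<dots> \<le> ennreal ((1 + \<eta>) * ?mh (z - z0))"
      using r2(2)[of z0 z] z(3) r2(1) by (simp add: z0)
    finally have "(1 - \<eta>) * ?mg (z - z0) \<le> (1 + \<eta>) * ?mh (z - z0)"
    proof (subst (asm) ennreal_le_iff)
      show "0 \<le> (1 + \<eta>) * ?mh (z - z0)"
        using h.metric_matrix_pos[OF c x, of "z - z0"] \<eta> by (cases "z - z0 = 0") (auto simp: form_norm_def)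
    qed
    then have "s * ((1 - \<eta>) * ?mg w) \<le> s * ((1 + \<eta>) * ?mh w)"
      using s by (simp add: z_def form_norm_scaleR mult.left_commute)
    then show ?thesis using s by (simp only: mult_le_cancel_left_pos)
  qed
  then have ev: "\<forall>\<^sub>F \<eta> in at_right 0. (1 - \<eta>) * ?mg w \<le> (1 + \<eta>) * ?mh w"
    unfolding eventually_at_right_field by (intro exI[of _ 1]) auto
  have "((\<lambda>\<eta>. (1 - \<eta>) * ?mg w) \<longlongrightarrow> (1 - 0) * ?mg w) (at_right 0)"
    "((\<lambda>\<eta>. (1 + \<eta>) * ?mh w) \<longlongrightarrow> (1 + 0) * ?mh w) (at_right 0)"
    by (intro tendsto_intros)+
  from tendsto_le[OF _ this(2,1) ev] show ?thesis by simp
qed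

section \<open>Riemannian volume in a chart\<close>

context continuous_metric
begin

abbreviation vol_density :: "('a, 'n) chart \<Rightarrow> real ^ 'n \<Rightarrow> real" where
  "vol_density c z \<equiv> sqrt (det (G c (chart_inv c z)))"

text \<open>
  The volume of the coordinate patch \<open>chart_dom c\<close> alone, extended by 0 to the whole manifold. The value
  \<open>undefined\<close> is taken only where the density vanishes.
\<close>

definition chart_volume :: "('a, 'n) chart \<Rightarrow> 'a measure" where
  "chart_volume c = distr
     (density lborel (\<lambda>z. ennreal (indicator (chart_image c) z * vol_density c z))) borel
     (\<lambda>z. if z \<in> chart_image c then chart_inv c z else undefined)"

lemma det_pos:
  assumes "c \<in> A" "x \<in> chart_dom c"
  shows "0 < det (G c x)"
  by (rule det_pos_if_positive_definite) (rule metric_matrix_pos[OF assms])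

lemma continuous_vol_density:
  assumes "c \<in> A"
  shows "continuous_on (chart_image c) (vol_density c)"
  unfolding det_def
  by (intro continuous_intros continuous_metric_matrix[OF assms])

lemma vol_density_measurable:
  assumes c: "c \<in> A" and V: "V \<in> sets borel" "V \<subseteq> chart_image c"
  shows "(\<lambda>z. indicator V z * vol_density c z) \<in> borel_measurable borel"
  using borel_measurable_continuous_on_indicator[OF V(1) continuous_on_subset[OF continuous_vol_density[OF c] V(2)]]
  by simp

lemma chart_inv_measurable:
  assumes c: "c \<in> A"
  shows "(\<lambda>z. if z \<in> chart_image c then chart_inv c z else undefined) \<in> borel_measurable borel"
  using open_chart_image[OF c] by (intro borel_measurable_continuous_on_if) (auto intro: continuous_chart_inv[OF c])

lemma sets_chart_volume [simp]: "sets (chart_volume c) = sets borel"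
  by (simp add: chart_volume_def)

lemma emeasure_chart_volume:
  assumes c: "c \<in> A" and B: "B \<in> sets borel" "B \<subseteq> chart_dom c"
  shows "emeasure (chart_volume c) B = (\<integral>\<^sup>+z\<in>chart_map c ` B. ennreal (vol_density c z) \<partial>lborel)"
proof -
  let ?\<psi> = "\<lambda>z. if z \<in> chart_image c then chart_inv c z else undefined"
  note meas [measurable] = chart_inv_measurable[OF c]
    vol_density_measurable[OF c borel_open[OF open_chart_image[OF c]] order_refl]
  have "emeasure (chart_volume c) B = emeasure
      (density lborel (\<lambda>z. ennreal (indicator (chart_image c) z * vol_density c z))) (?\<psi> -` B)"
    unfolding chart_volume_def using B(1) by (subst emeasure_distr) auto
  also have "\<dots> = (\<integral>\<^sup>+z. ennreal (indicator (chart_image c) z * vol_density c z) * indicator (?\<psi> -` B) z \<partial>lborel)"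
    by (rule emeasure_density) (use measurable_sets_borel[OF meas(1) B(1)] in auto)
  also have "\<dots> = (\<integral>\<^sup>+z\<in>chart_map c ` B. ennreal (vol_density c z) \<partial>lborel)"
    unfolding chart_map_image_eq[OF c B(2)] by (rule nn_integral_cong) (auto simp: indicator_def)
  finally show ?thesis .
qed

text \<open>
  Change of variables along the transition map; its Jacobian is the factor between the densities.
\<close>

lemma emeasure_chart_volume_change:
  assumes c: "c \<in> A" "c' \<in> A" and B: "B \<in> sets borel" "B \<subseteq> chart_dom c" "B \<subseteq> chart_dom c'"
  shows "emeasure (chart_volume c) B = emeasure (chart_volume c') B"
proof -
  let ?S = "chart_map c ` B" and ?T = "transition c c'"
  have in_S: "chart_inv c z \<in> B \<and> z = chart_map c (chart_inv c z)" if "z \<in> ?S" for z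
    using that B(2) chart_inv_map[OF c(1)] by auto
  have TS: "?T ` ?S = chart_map c' ` B"
    using B(2) transition_chart_map[OF c(1), of _ c'] by (force simp: image_image)
  have S: "?S \<in> sets borel" "?S \<subseteq> chart_image c" and S': "chart_map c' ` B \<in> sets borel" "chart_map c' ` B \<subseteq> chart_image c'"
    using B borel_chart_map_image[OF c(1) B(1,2)] borel_chart_map_image[OF c(2) B(1,3)] by auto
  have "(\<integral>\<^sup>+z\<in>?T ` ?S. ennreal (vol_density c' z) \<partial>lborel) = (\<integral>\<^sup>+z\<in>?S. ennreal (vol_density c z) \<partial>lborel)"
  proof (rule nn_integral_change_of_variables[where T' = "\<lambda>z. frechet_derivative ?T (at z)"])
    show "?S \<in> sets borel" by (rule S(1))
    fix z assume z: "z \<in> ?S"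
    let ?x = "chart_inv c z"
    have x: "?x \<in> chart_dom c" "?x \<in> chart_dom c'" "chart_map c ?x = z" using in_S[OF z] B(2,3) by auto
    show "(?T has_derivative frechet_derivative ?T (at z)) (at z)"
      using transition_has_derivative[OF c x(1,2)] unfolding x(3) .
    have "chart_inv c' (?T z) = ?x"
      using x(2) by (simp add: transition_def chart_inv_map[OF c(2)])
    then show "vol_density c z = \<bar>det (matrix (frechet_derivative ?T (at z)))\<bar> * vol_density c' (?T z)"
      using det_metric_change[OF c x(1,2)] unfolding x(3) by simp
  next
    show "inj_on ?T ?S"
    proof (rule inj_onI)
      fix y z assume yz: "y \<in> ?S" "z \<in> ?S" "?T y = ?T z"
      have "chart_map c' (chart_inv c y) = chart_map c' (chart_inv c z)" using yz(3) by (simp add: transition_def)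
      then have "chart_inv c y = chart_inv c z"
        using inj_onD[OF inj_on_chart_map[OF c(2)]] in_S[OF yz(1)] in_S[OF yz(2)] B(3) by blast
      then show "y = z" using in_S[OF yz(1)] in_S[OF yz(2)] by metis
    qed
    show "0 \<le> vol_density c' y" if y: "y \<in> ?T ` ?S" for y
    proof -
      have "y \<in> chart_image c'" using y unfolding TS using S'(2) by blast
      then show ?thesis using det_pos[OF c(2) chart_inv_in_dom[OF c(2)], of y] by simp
    qed
    show "(\<lambda>y. indicator (?T ` ?S) y * vol_density c' y) \<in> borel_measurable borel"
      unfolding TS by (rule vol_density_measurable[OF c(2) S'])
    show "(\<lambda>y. indicator ?S y * vol_density c y) \<in> borel_measurable borel"
      by (rule vol_density_measurable[OF c(1) S])
  qed
  then show ?thesis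
    unfolding emeasure_chart_volume[OF c(1) B(1,2)] emeasure_chart_volume[OF c(2) B(1,3)] TS by simp
qed

lemma is_riemannian_volume_iff:
  "is_riemannian_volume A g \<mu> \<longleftrightarrow> sets \<mu> = sets borel \<and>
    (\<forall>c\<in>A. \<forall>B\<in>sets borel. B \<subseteq> chart_dom c \<longrightarrow> emeasure \<mu> B = emeasure (chart_volume c) B)"
  unfolding is_riemannian_volume_def using emeasure_chart_volume by auto

text \<open>
  Compactness gives a finite cover by chart domains, which is then made disjoint. Cutting Borel sets along
  the pieces reduces uniqueness of the volume to single charts, and adding up the chart volumes of
  the parts proves its existence.
\<close>

lemma finite_disjoint_chart_cover:
  assumes "compact (UNIV :: 'a set)"
  obtains n :: nat and c W where "\<And>i. i < n \<Longrightarrow> c i \<in> A \<and> W i \<in> sets borel \<and> W i \<subseteq> chart_dom (c i)"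
    "disjoint_family_on W {..<n}" "(\<Union>i<n. W i) = UNIV"
proof -
  have "\<exists>C'\<subseteq>A. finite C' \<and> UNIV \<subseteq> (\<Union>c\<in>C'. chart_dom c)"
  proof (rule compactE_image[OF assms, of A chart_dom])
    show "open (chart_dom c)" if "c \<in> A" for c using that by (rule open_chart_dom)
    show "UNIV \<subseteq> (\<Union>c\<in>A. chart_dom c)" using smooth_atlas by (simp add: smooth_atlas_def)
  qed blast
  then obtain C' where C': "C' \<subseteq> A" "finite C'" "UNIV \<subseteq> (\<Union>c\<in>C'. chart_dom c)" by blast
  obtain n :: nat and c where c: "C' = c ` {i. i < n}"
    using finite_imp_nat_seg_image_inj_on[OF C'(2)] by blast
  have cA: "c i \<in> A" if "i < n" for i using that c C'(1) by auto
  define U where "U = (\<lambda>i. if i < n then chart_dom (c i) else {})"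
  show ?thesis
  proof (rule that[of n c "disjointed U"])
    fix i assume i: "i < n"
    have "U j \<in> sets borel" for j using open_chart_dom[OF cA] by (auto simp: U_def)
    then have "disjointed U i \<in> sets borel" using sets.range_disjointed_sets[of U borel] by blast
    moreover have "disjointed U i \<subseteq> chart_dom (c i)" using disjointed_subset[of U i] i by (auto simp: U_def)
    ultimately show "c i \<in> A \<and> disjointed U i \<in> sets borel \<and> disjointed U i \<subseteq> chart_dom (c i)"
      using cA[OF i] by blast
  next
    show "disjoint_family_on (disjointed U) {..<n}"
      using disjoint_family_disjointed by (rule disjoint_family_on_mono[rotated]) simp
    have "x \<in> (\<Union>i<n. disjointed U i)" for x
    proof -
      obtain i where "i < n" "x \<in> chart_dom (c i)" using C'(3) c by auto
      then have "x \<in> U i" by (simp add: U_def)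
      then have "x \<in> (\<Union>i. disjointed U i)" unfolding UN_disjointed_eq by (rule UN_I[OF UNIV_I])
      then obtain j where j: "x \<in> disjointed U j" by (rule UN_E)
      then have "x \<in> U j" using disjointed_subset[of U j] by (rule set_mp[rotated])
      then have "j < n" by (cases "j < n") (simp_all add: U_def)
      then show ?thesis using j by blast
    qed
    then show "(\<Union>i<n. disjointed U i) = UNIV" by blast
  qed
qed

lemma emeasure_disjoint_pieces:
  assumes "sets \<mu> = sets borel" "disjoint_family_on W {..<n :: nat}"
    and "\<And>i. i < n \<Longrightarrow> W i \<in> sets borel" "(\<Union>i<n. W i) = UNIV" "B \<in> sets borel"
  shows "emeasure \<mu> B = (\<Sum>i<n. emeasure \<mu> (B \<inter> W i))"
proof -
  have "(\<Sum>i<n. emeasure \<mu> (B \<inter> W i)) = emeasure \<mu> (\<Union>i<n. B \<inter> W i)"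
    using assms by (intro sum_emeasure) (auto simp: disjoint_family_on_def)
  also have "(\<Union>i<n. B \<inter> W i) = B" using assms(4) by blast
  finally show ?thesis by simp
qed

lemma is_riemannian_volume_unique:
  assumes comp: "compact (UNIV :: 'a set)"
    and \<mu>: "is_riemannian_volume A g \<mu>" and \<nu>: "is_riemannian_volume A g \<nu>"
  shows "\<mu> = \<nu>"
proof (rule measure_eqI)
  obtain n c W where W: "\<And>i. i < (n :: nat) \<Longrightarrow> c i \<in> A \<and> W i \<in> sets borel \<and> W i \<subseteq> chart_dom (c i)"
    "disjoint_family_on W {..<n}" "(\<Union>i<n. W i) = UNIV"
    by (rule finite_disjoint_chart_cover[OF comp]) blast
  have sets: "sets \<mu> = sets borel" "sets \<nu> = sets borel"
    using \<mu> \<nu> unfolding is_riemannian_volume_def by auto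
  then show "sets \<mu> = sets \<nu>" by simp
  fix B assume "B \<in> sets \<mu>"
  then have B: "B \<in> sets borel" using sets by simp
  have "emeasure \<mu> (B \<inter> W i) = emeasure \<nu> (B \<inter> W i)" if "i < n" for i
  proof -
    have "B \<inter> W i \<in> sets borel" "B \<inter> W i \<subseteq> chart_dom (c i)" "c i \<in> A" using W(1)[OF that] B by auto
    then show ?thesis using \<mu> \<nu> unfolding is_riemannian_volume_iff by simp
  qed
  moreover have "emeasure M B = (\<Sum>i<n. emeasure M (B \<inter> W i))" if "sets M = sets borel" for M
    by (rule emeasure_disjoint_pieces[OF that W(2) _ W(3) B]) (use W(1) in blast)
  ultimately show "emeasure \<mu> B = emeasure \<nu> B"
    using sets by simp
qed

text \<open>
  The measure \<open>m\<close> adds up the chart volumes of the pieces of a set. On subsets of another chart domain it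
  gives the right value because each piece may be measured in either chart.
\<close>

lemma is_riemannian_volume_exists:
  assumes comp: "compact (UNIV :: 'a set)"
  shows "\<exists>\<mu>. is_riemannian_volume A g \<mu>"
proof -
  obtain n c W where W: "\<And>i. i < (n :: nat) \<Longrightarrow> c i \<in> A \<and> W i \<in> sets borel \<and> W i \<subseteq> chart_dom (c i)"
    "disjoint_family_on W {..<n}" "(\<Union>i<n. W i) = UNIV"
    by (rule finite_disjoint_chart_cover[OF comp]) blast
  define m where "m B = (\<Sum>i<n. emeasure (chart_volume (c i)) (B \<inter> W i))" for B
  define \<mu> where "\<mu> = measure_of UNIV (sets borel) m"
  have ca: "countably_additive (sets borel) m"
    unfolding countably_additive_def
  proof (intro allI impI)
    fix F :: "nat \<Rightarrow> 'a set" assume F: "range F \<subseteq> sets borel" "disjoint_family F"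
    have "(\<Sum>k. m (F k)) = (\<Sum>i<n. \<Sum>k. emeasure (chart_volume (c i)) (F k \<inter> W i))"
      unfolding m_def by (rule suminf_sum) simp
    also have "\<dots> = m (\<Union>k. F k)"
      unfolding m_def
    proof (rule sum.cong[OF refl])
      fix i assume "i \<in> {..<n}"
      then have Wi: "W i \<in> sets borel" using W(1) by simp
      have "(\<Sum>k. emeasure (chart_volume (c i)) (F k \<inter> W i)) = emeasure (chart_volume (c i)) (\<Union>k. F k \<inter> W i)"
        using F Wi by (intro suminf_emeasure) (auto simp: disjoint_family_on_def)
      also have "(\<Union>k. F k \<inter> W i) = (\<Union>k. F k) \<inter> W i" by blast
      finally show "(\<Sum>k. emeasure (chart_volume (c i)) (F k \<inter> W i)) = emeasure (chart_volume (c i)) ((\<Union>k. F k) \<inter> W i)" .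
    qed
    finally show "(\<Sum>k. m (F k)) = m (\<Union>k. F k)" .
  qed
  have sets_\<mu>: "sets \<mu> = sets borel"
    unfolding \<mu>_def using sets.sigma_sets_eq[of borel] by (simp add: sets_measure_of)
  have em: "emeasure \<mu> B = m B" if "B \<in> sets borel" for B
  proof (rule emeasure_measure_of[OF \<mu>_def])
    show "sets borel \<subseteq> Pow UNIV" by simp
    show "B \<in> sets \<mu>" using that sets_\<mu> by simp
    show "positive (sets \<mu>) m" by (simp add: positive_def m_def)
    show "countably_additive (sets \<mu>) m" using ca sets_\<mu> by simp
  qed
  have "emeasure \<mu> B = emeasure (chart_volume c') B"
    if c': "c' \<in> A" and B: "B \<in> sets borel" "B \<subseteq> chart_dom c'" for c' B
  proof -
    have "m B = (\<Sum>i<n. emeasure (chart_volume c') (B \<inter> W i))"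
      unfolding m_def using W(1) B c' by (intro sum.cong refl emeasure_chart_volume_change) auto
    also have "\<dots> = emeasure (chart_volume c') B"
      using W B by (intro emeasure_disjoint_pieces[symmetric]) auto
    finally show ?thesis using em[OF B(1)] by simp
  qed
  then have "is_riemannian_volume A g \<mu>" unfolding is_riemannian_volume_iff using sets_\<mu> by blast
  then show ?thesis by blast
qed

lemma is_riemannian_volume_riemannian_volume:
  assumes "compact (UNIV :: 'a set)"
  shows "is_riemannian_volume A g (riemannian_volume A g)"
  unfolding riemannian_volume_def
  by (rule theI') (metis is_riemannian_volume_exists is_riemannian_volume_unique assms)

text \<open>
  Restricted to the chart domain, the Riemannian volume is the chart volume, which is the
  image of a measure with a density on \<open>\<real>\<^sup>n\<close>.
\<close>

lemma integral_riemannian_volume: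
  fixes F :: "'a \<Rightarrow> real"
  assumes comp: "compact (UNIV :: 'a set)" and c: "c \<in> A"
    and F: "F \<in> borel_measurable borel" and supp: "\<And>y. y \<notin> chart_dom c \<Longrightarrow> F y = 0"
  shows "(LINT y|riemannian_volume A g. F y) =
    (LINT z|lborel. indicator (chart_image c) z * vol_density c z * F (chart_inv c z))"
proof -
  let ?\<mu> = "riemannian_volume A g" and ?I = "\<lambda>y. indicator (chart_dom c) y :: real"
  have \<mu>: "sets ?\<mu> = sets borel"
    "\<And>B. B \<in> sets borel \<Longrightarrow> B \<subseteq> chart_dom c \<Longrightarrow> emeasure ?\<mu> B = emeasure (chart_volume c) B"
    using is_riemannian_volume_riemannian_volume[OF comp] c unfolding is_riemannian_volume_iff by blast+
  have dom [measurable]: "chart_dom c \<in> sets borel" using open_chart_dom[OF c] by simp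
  have I: "?I \<in> borel_measurable ?\<mu>" "?I \<in> borel_measurable (chart_volume c)"
    by (simp_all add: measurable_cong_sets[OF \<mu>(1) refl] measurable_cong_sets[OF sets_chart_volume refl])
  have F': "F \<in> borel_measurable ?\<mu>" "F \<in> borel_measurable (chart_volume c)"
    using F by (simp_all add: measurable_cong_sets[OF \<mu>(1) refl] measurable_cong_sets[OF sets_chart_volume refl])
  have eq: "density ?\<mu> ?I = density (chart_volume c) ?I"
  proof (rule measure_eqI)
    show "sets (density ?\<mu> ?I) = sets (density (chart_volume c) ?I)" using \<mu>(1) by simp
    fix B assume "B \<in> sets (density ?\<mu> ?I)"
    then have B: "B \<in> sets borel" using \<mu>(1) by simp
    have "emeasure (density M ?I) B = emeasure M (chart_dom c \<inter> B)" if "sets M = sets borel" for M :: "'a measure"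
    proof -
      have "emeasure (density M ?I) B = (\<integral>\<^sup>+y. ennreal (?I y) * indicator B y \<partial>M)"
        using B that by (intro emeasure_density) (simp_all add: measurable_cong_sets[OF that refl])
      also have "\<dots> = (\<integral>\<^sup>+y. indicator (chart_dom c \<inter> B) y \<partial>M)"
        by (rule nn_integral_cong) (auto simp: indicator_def)
      also have "\<dots> = emeasure M (chart_dom c \<inter> B)" using B that dom by (intro nn_integral_indicator) auto
      finally show ?thesis .
    qed
    then show "emeasure (density ?\<mu> ?I) B = emeasure (density (chart_volume c) ?I) B"
      using \<mu> B dom by simp
  qed
  have IF: "?I y *\<^sub>R F y = F y" for y
    using supp[of y] by (cases "y \<in> chart_dom c") auto
  have "(LINT y|?\<mu>. F y) = (LINT y|density ?\<mu> ?I. F y)"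
    by (subst integral_density[OF F'(1) I(1)]) (simp_all only: IF, simp)
  also have "\<dots> = (LINT y|chart_volume c. F y)"
    unfolding eq by (subst integral_density[OF F'(2) I(2)]) (simp_all only: IF, simp)
  also have "\<dots> = (LINT z|density lborel (\<lambda>z. ennreal (indicator (chart_image c) z * vol_density c z)).
      F (if z \<in> chart_image c then chart_inv c z else undefined))"
    unfolding chart_volume_def using chart_inv_measurable[OF c] F by (subst integral_distr) auto
  also have "\<dots> = (LINT z|lborel. (indicator (chart_image c) z * vol_density c z) *\<^sub>R
      F (if z \<in> chart_image c then chart_inv c z else undefined))"
  proof (rule integral_density)
    show "(\<lambda>z. F (if z \<in> chart_image c then chart_inv c z else undefined)) \<in> borel_measurable lborel"
      using measurable_compose[OF chart_inv_measurable[OF c] F] by simp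
    show "(\<lambda>z. indicator (chart_image c) z * vol_density c z) \<in> borel_measurable lborel"
      using vol_density_measurable[OF c borel_open[OF open_chart_image[OF c]] order_refl] by simp
    show "AE z in lborel. 0 \<le> indicator (chart_image c) z * vol_density c z"
      using det_pos[OF c chart_inv_in_dom[OF c]] by (auto simp: indicator_def intro!: AE_I2 less_imp_le)
  qed
  also have "\<dots> = (LINT z|lborel. indicator (chart_image c) z * vol_density c z * F (chart_inv c z))"
    by (rule Bochner_Integration.integral_cong) (auto simp: indicator_def)
  finally show ?thesis .
qed

end

section \<open>The operator as a family of integral kernels\<close>

text \<open>
  If \<open>H1 > H2\<close> at \<open>z\<close>, then also on a small ball around \<open>z\<close>, and the bump function supported in that ball
  has different integrals against \<open>H1\<close> and \<open>H2\<close>.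
\<close>

lemma bump_integrals_determine_le:
  fixes H1 H2 :: "'b::euclidean_space \<Rightarrow> real"
  assumes S: "open S" and H: "continuous_on S H1" "continuous_on S H2"
    and eq: "\<And>z \<rho>. \<rho> > 0 \<Longrightarrow> cball z \<rho> \<subseteq> S \<Longrightarrow>
      (LINT u|lborel. max 0 (\<rho> - dist z u) * H1 u) = (LINT u|lborel. max 0 (\<rho> - dist z u) * H2 u)"
    and z: "z \<in> S"
  shows "H1 z \<le> H2 z"
proof (rule ccontr)
  let ?D = "\<lambda>u. H1 u - H2 u"
  assume "\<not> H1 z \<le> H2 z"
  then have Dz: "?D z > 0" by simp
  have D: "continuous_on S ?D" by (intro continuous_intros H)
  have "open {u \<in> S. ?D u \<in> {0<..}}"
    using continuous_open_preimage[OF D S open_greaterThan[of 0]] by (simp add: Int_def vimage_def)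
  then obtain \<rho> where \<rho>: "\<rho> > 0" "cball z \<rho> \<subseteq> {u \<in> S. ?D u \<in> {0<..}}"
    using z Dz open_contains_cball_eq by (metis (mono_tags, lifting) greaterThan_iff mem_Collect_eq)
  then have pos: "?D u > 0" if "u \<in> cball z \<rho>" for u using that by blast
  have sub: "cball z \<rho> \<subseteq> S" using \<rho>(2) by blast
  let ?b = "\<lambda>u. max 0 (\<rho> - dist z u)"
  have int: "integrable lborel (\<lambda>u. ?b u * H u)" if "continuous_on S H" for H :: "'b \<Rightarrow> real"
  proof -
    have "integrable lborel (\<lambda>u. indicator (cball z \<rho>) u *\<^sub>R (?b u * H u))"
      by (intro borel_integrable_compact continuous_intros continuous_on_subset[OF that sub]) auto
    moreover have "(\<lambda>u. indicator (cball z \<rho>) u *\<^sub>R (?b u * H u)) = (\<lambda>u. ?b u * H u)"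
      by (rule ext) (auto simp: indicator_def)
    ultimately show ?thesis by simp
  qed
  have int_D: "integrable lborel (\<lambda>u. ?b u * ?D u)" by (rule int[OF D])
  have "(LINT u|lborel. ?b u * ?D u) = (LINT u|lborel. ?b u * H1 u) - (LINT u|lborel. ?b u * H2 u)"
    unfolding right_diff_distrib by (intro Bochner_Integration.integral_diff int H)
  also have "\<dots> = 0" using eq[OF \<rho>(1) sub] by simp
  finally have "(LINT u|lborel. ?b u * ?D u) = 0" .
  moreover have "0 \<le> ?b u * ?D u" for u
  proof (cases "u \<in> cball z \<rho>")
    case True
    then show ?thesis using pos by (intro mult_nonneg_nonneg) (auto intro: less_imp_le)
  qed simp
  ultimately have "AE u in lborel. ?b u * ?D u = 0"
    using integral_nonneg_eq_0_iff_AE[OF int_D] by simp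
  then have "AE u in lborel. u \<notin> ball z \<rho>"
  proof (rule AE_mp, intro AE_I2 impI notI)
    fix u assume "?b u * ?D u = 0" "u \<in> ball z \<rho>"
    then show False using pos[of u] by auto
  qed
  then have "ball z \<rho> \<in> null_sets lborel" by (subst AE_iff_null_sets) auto
  then have "negligible (ball z \<rho>)" by (simp add: negligible_iff_null_sets null_sets_completionI)
  then show False using open_not_negligible[OF open_ball, of z \<rho>] \<rho>(1) by auto
qed

lemma bump_integrals_determine:
  fixes H1 H2 :: "'b::euclidean_space \<Rightarrow> real"
  assumes "open S" "continuous_on S H1" "continuous_on S H2"
    and "\<And>z \<rho>. \<rho> > 0 \<Longrightarrow> cball z \<rho> \<subseteq> S \<Longrightarrow>
      (LINT u|lborel. max 0 (\<rho> - dist z u) * H1 u) = (LINT u|lborel. max 0 (\<rho> - dist z u) * H2 u)"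
    and "z \<in> S"
  shows "H1 z = H2 z"
  using bump_integrals_determine_le[of S H1 H2 z] bump_integrals_determine_le[of S H2 H1 z] assms
  by (intro antisym) auto

lemma gauss_kernel_inject:
  assumes "t > 0" "r \<noteq> \<infinity>" "s \<noteq> \<infinity>" "gauss_kernel t r = gauss_kernel t s"
  shows "r = s"
proof -
  have "(enn2real r)\<^sup>2 = (enn2real s)\<^sup>2" using assms by (simp add: gauss_kernel_def)
  then have "enn2real r = enn2real s" by (simp add: power2_eq_iff_nonneg)
  then show ?thesis using assms(2,3) by (metis ennreal_enn2real infinity_ennreal_def less_top)
qed

definition chart_bump :: "('a, 'n) chart \<Rightarrow> (real ^ 'n \<Rightarrow> real) \<Rightarrow> 'a \<Rightarrow> real" where
  "chart_bump c b y = (if y \<in> chart_dom c then b (chart_map c y) else 0)"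

text \<open>
  The extension is continuous because the support is compact, and so closed in the Hausdorff space \<open>'a\<close>.
\<close>

lemma (in smooth_manifold) continuous_chart_bump:
  assumes c: "c \<in> A" and b: "continuous_on UNIV b"
    and K: "compact K" "K \<subseteq> chart_image c" "\<And>z. z \<notin> K \<Longrightarrow> b z = 0"
  shows "continuous_on UNIV (chart_bump c b)"
proof -
  let ?K = "chart_inv c ` K"
  have "compact ?K"
    using K(1) continuous_on_subset[OF continuous_chart_inv[OF c] K(2)] by (rule compact_continuous_image[rotated])
  then have "open (- ?K)" by (intro open_Compl compact_imp_closed)
  have "continuous_on (chart_dom c) (\<lambda>y. b (chart_map c y))"
    by (rule continuous_on_compose2[OF b continuous_chart_map[OF c]]) simp
  then have 1: "continuous_on (chart_dom c) (chart_bump c b)"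
    by (rule continuous_on_eq) (simp add: chart_bump_def)
  have "chart_bump c b y = 0" if "y \<in> - ?K" for y
  proof (cases "y \<in> chart_dom c")
    case True
    then have "chart_map c y \<notin> K" using that chart_inv_map[OF c True] by (metis ComplD image_eqI)
    then show ?thesis using K(3) by (simp add: chart_bump_def)
  qed (simp add: chart_bump_def)
  then have 2: "continuous_on (- ?K) (chart_bump c b)"
    by (intro continuous_on_eq[OF continuous_on_const]) auto
  have "chart_dom c \<union> - ?K = UNIV" using K(2) chart_inv_in_dom[OF c] by blast
  then show ?thesis
    using continuous_on_open_Un[OF open_chart_dom[OF c] \<open>open (- ?K)\<close> 1 2] by simp
qed

context continuous_metric
begin

abbreviation kernel :: "real \<Rightarrow> 'a \<Rightarrow> 'a \<Rightarrow> real" where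
  "kernel t x y \<equiv> gauss_kernel t (geodesic_dist A g x y)"

text \<open>
  By the triangle inequality, \<open>geodesic_dist A g x\<close> changes between two nearby points by at most their
  own distance, which is bounded by the norm of their difference in coordinates. The choice \<open>\<eta> = 1 / 2\<close> is
  arbitrary.
\<close>

lemma kernel_local:
  assumes c: "c \<in> A" and x: "x \<in> chart_dom c"
  obtains r where "r > 0" "ball (chart_map c x) r \<subseteq> chart_image c"
    "\<And>z. z \<in> ball (chart_map c x) r \<Longrightarrow> geodesic_dist A g x (chart_inv c z) \<noteq> \<infinity>"
    "continuous_on (ball (chart_map c x) r) (\<lambda>z. kernel t x (chart_inv c z))"
    "kernel t x x = 1"
proof -
  define z0 where "z0 = chart_map c x"
  have z0: "chart_inv c z0 = x" using c x by (simp add: z0_def chart_inv_map)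
  let ?m = "\<lambda>w. (1 + 1 / 2) * form_norm (G c x) w" and ?d = "\<lambda>z. geodesic_dist A g x (chart_inv c z)"
  obtain r where r: "r > 0" "ball z0 r \<subseteq> chart_image c"
    and up: "\<And>z z'. z \<in> ball z0 r \<Longrightarrow> z' \<in> ball z0 r \<Longrightarrow>
      geodesic_dist A g (chart_inv c z) (chart_inv c z') \<le> ennreal (?m (z' - z))"
    unfolding z0_def by (rule geodesic_dist_local[OF c x, of "1 / 2"], simp, simp) blast
  have m: "0 \<le> ?m w" "?m (- w) = ?m w" for w
  proof -
    show "0 \<le> ?m w" using metric_matrix_pos[OF c x, of w] by (cases "w = 0") (auto simp: form_norm_def)
    show "?m (- w) = ?m w" using form_norm_scaleR[of "G c x" "- 1" w] by simp
  qed
  have fin: "?d z \<noteq> \<infinity>" if "z \<in> ball z0 r" for z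
    using up[OF _ that, of z0] r(1) by (auto simp: z0 top_unique)
  define \<delta> where "\<delta> z = enn2real (?d z)" for z
  have le: "\<delta> z' \<le> \<delta> z + ?m (z' - z)" if "z \<in> ball z0 r" "z' \<in> ball z0 r" for z z'
  proof -
    have "ennreal (\<delta> z') = ?d z'" "ennreal (\<delta> z) = ?d z" using fin that by (simp_all add: \<delta>_def less_top)
    moreover have "?d z' \<le> ?d z + ennreal (?m (z' - z))"
      using geodesic_dist_triangle add_left_mono[OF up[OF that]] by (rule order_trans)
    ultimately have "ennreal (\<delta> z') \<le> ennreal (\<delta> z + ?m (z' - z))"
      using m(1) by (simp add: \<delta>_def)
    then show ?thesis using m(1)[of "z' - z"] by (subst (asm) ennreal_le_iff) (simp_all add: \<delta>_def)
  qed
  have "continuous_on (ball z0 r) \<delta>"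
    unfolding continuous_on_def
  proof
    fix z assume z: "z \<in> ball z0 r"
    have "continuous_on UNIV (\<lambda>u. ?m (u - z))" by (intro continuous_intros)
    then have "((\<lambda>u. ?m (u - z)) \<longlongrightarrow> ?m (z - z)) (at z within ball z0 r)"
      by (metis UNIV_I continuous_on_def tendsto_within_subset subset_UNIV)
    then have "((\<lambda>u. ?m (u - z)) \<longlongrightarrow> 0) (at z within ball z0 r)" by (simp add: form_norm_def)
    moreover have "\<forall>\<^sub>F u in at z within ball z0 r. norm (\<delta> u - \<delta> z) \<le> ?m (u - z)"
    proof (rule eventually_at_filter[THEN iffD2], rule always_eventually, intro allI impI)
      fix u assume u: "u \<in> ball z0 r"
      have "\<delta> z \<le> \<delta> u + ?m (u - z)" using le[OF u z] m(2)[of "u - z"] by simp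
      then show "norm (\<delta> u - \<delta> z) \<le> ?m (u - z)" using le[OF z u]
        unfolding real_norm_def abs_le_iff by linarith
    qed
    ultimately have "((\<lambda>u. \<delta> u - \<delta> z) \<longlongrightarrow> 0) (at z within ball z0 r)"
      by (rule Lim_null_comparison[rotated])
    then show "(\<delta> \<longlongrightarrow> \<delta> z) (at z within ball z0 r)" by (simp add: LIM_zero_iff)
  qed
  then have "continuous_on (ball z0 r) (\<lambda>z. exp (- (\<delta> z)\<^sup>2 / t))"
    unfolding divide_inverse by (intro continuous_intros)
  then have cont: "continuous_on (ball z0 r) (\<lambda>z. kernel t x (chart_inv c z))"
    by (rule continuous_on_eq) (use fin in \<open>auto simp: gauss_kernel_def \<delta>_def\<close>)
  have "geodesic_dist A g x x = 0" using up[of z0 z0] r(1) by (simp add: z0 form_norm_def)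
  then have "kernel t x x = 1" by (simp add: gauss_kernel_def)
  then show ?thesis using that[of r] r fin cont unfolding z0_def by blast
qed

text \<open>
  Since the bump function vanishes at \<open>x\<close>, the operator integrates it, with a minus sign, against
  the weighted kernel.
\<close>

lemma L_op_chart_bump:
  assumes comp: "compact (UNIV :: 'a set)" and c: "c \<in> A" and x: "x \<in> chart_dom c"
    and p: "continuous_on UNIV p" and b: "continuous_on UNIV b"
    and V: "open V" "V \<subseteq> chart_image c" and supp: "\<And>z. z \<notin> V \<Longrightarrow> b z = 0"
    and bx: "b (chart_map c x) = 0"
    and k: "continuous_on V (\<lambda>z. kernel t x (chart_inv c z))"
  shows "L_op A t g p (chart_bump c b) x = - (1 / t powr (real CARD('n) / 2 + 1)) *
    (LINT z|lborel. b z * (kernel t x (chart_inv c z) * p (chart_inv c z) * vol_density c z))"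
proof -
  let ?f = "chart_bump c b"
  let ?F = "\<lambda>y. kernel t x y * (?f x - ?f y) * p y"
  let ?O = "chart_inv c ` V"
  have fx: "?f x = 0" using bx x by (simp add: chart_bump_def)
  have O: "open ?O" by (rule open_chart_inv_image[OF c V])
  have Oe: "?O = chart_dom c \<inter> chart_map c -` V" by (rule chart_inv_image_eq[OF c V(2)])
  have out: "?f y = 0" if "y \<notin> ?O" for y
    using that supp unfolding Oe by (auto simp: chart_bump_def)
  have "continuous_on ?O (\<lambda>y. kernel t x (chart_inv c (chart_map c y)))"
    by (rule continuous_on_compose2[OF k continuous_on_subset[OF continuous_chart_map[OF c]]])
      (auto simp: Oe)
  then have kO: "continuous_on ?O (kernel t x)"
    by (rule continuous_on_eq) (simp add: Oe chart_inv_map[OF c])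
  have "continuous_on ?O (\<lambda>y. b (chart_map c y))"
    by (rule continuous_on_compose2[OF b continuous_on_subset[OF continuous_chart_map[OF c]]])
      (auto simp: Oe)
  then have fO: "continuous_on ?O ?f"
    by (rule continuous_on_eq) (simp add: Oe chart_bump_def)
  have "continuous_on ?O ?F"
    by (intro continuous_intros kO fO continuous_on_subset[OF p]) simp
  then have "(\<lambda>y. indicator ?O y *\<^sub>R ?F y) \<in> borel_measurable borel"
    by (intro borel_measurable_continuous_on_indicator borel_open O)
  moreover have "(\<lambda>y. indicator ?O y *\<^sub>R ?F y) = ?F"
  proof
    fix y
    show "indicator ?O y *\<^sub>R ?F y = ?F y"
      using fx out[of y] by (cases "y \<in> ?O") simp_all
  qed
  ultimately have F: "?F \<in> borel_measurable borel" by simp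
  have "(LINT y|riemannian_volume A g. ?F y) =
      (LINT z|lborel. indicator (chart_image c) z * vol_density c z * ?F (chart_inv c z))"
    by (rule integral_riemannian_volume[OF comp c F]) (simp add: fx, simp add: chart_bump_def)
  also have "\<dots> = (LINT z|lborel. - (b z * (kernel t x (chart_inv c z) * p (chart_inv c z) * vol_density c z)))"
  proof (rule Bochner_Integration.integral_cong[OF refl])
    fix z
    show "indicator (chart_image c) z * vol_density c z * ?F (chart_inv c z) =
        - (b z * (kernel t x (chart_inv c z) * p (chart_inv c z) * vol_density c z))"
    proof (cases "z \<in> chart_image c")
      case True
      then have "?f (chart_inv c z) = b z" by (simp add: chart_bump_def chart_inv_in_dom[OF c] chart_map_inv[OF c])
      then show ?thesis using True fx by simp
    next
      case False
      then have "b z = 0" using V(2) supp by blast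
      then show ?thesis using False by simp
    qed
  qed
  also have "\<dots> = - (LINT z|lborel. b z * (kernel t x (chart_inv c z) * p (chart_inv c z) * vol_density c z))"
    by (rule Bochner_Integration.integral_minus)
  finally show ?thesis unfolding L_op_def by simp
qed

end

locale same_operator =
  m1: continuous_metric A g1 + m2: continuous_metric A g2
  for A :: "('a::t2_space, 'n::finite) chart set" and g1 g2 +
  fixes p1 p2 :: "'a \<Rightarrow> real" and t :: real
  assumes compact_UNIV: "compact (UNIV :: 'a set)"
    and t: "t > 0"
    and p1: "continuous_on UNIV p1" "\<And>x. 0 < p1 x"
    and p2: "continuous_on UNIV p2" "\<And>x. 0 < p2 x"
    and same: "\<And>f. continuous_on UNIV f \<Longrightarrow> L_op A t g1 p1 f = L_op A t g2 p2 f"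
begin

text \<open>
  Bump functions vanishing at \<open>x\<close> determine the densities on the punctured ball. At the centre they agree
  by continuity, as points of \<open>\<real>\<^sup>n\<close> are not isolated; that case is the one needed for
  \<open>weighted_volumes_eq\<close>.
\<close>

lemma kernel_densities_eq:
  assumes c: "c \<in> A" and x: "x \<in> chart_dom c"
  obtains r where "r > 0" "ball (chart_map c x) r \<subseteq> chart_image c"
    "\<And>z. z \<in> ball (chart_map c x) r \<Longrightarrow>
      geodesic_dist A g1 x (chart_inv c z) \<noteq> \<infinity> \<and> geodesic_dist A g2 x (chart_inv c z) \<noteq> \<infinity>"
    "\<And>z. z \<in> ball (chart_map c x) r \<Longrightarrow>
      m1.kernel t x (chart_inv c z) * p1 (chart_inv c z) * m1.vol_density c z =
      m2.kernel t x (chart_inv c z) * p2 (chart_inv c z) * m2.vol_density c z"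
    "m1.kernel t x x = 1" "m2.kernel t x x = 1"
proof -
  define z0 where "z0 = chart_map c x"
  have z0: "chart_inv c z0 = x" using c x by (simp add: z0_def m1.chart_inv_map)
  obtain r1 where r1: "r1 > 0" "ball z0 r1 \<subseteq> chart_image c"
    "\<And>z. z \<in> ball z0 r1 \<Longrightarrow> geodesic_dist A g1 x (chart_inv c z) \<noteq> \<infinity>"
    "continuous_on (ball z0 r1) (\<lambda>z. m1.kernel t x (chart_inv c z))" "m1.kernel t x x = 1"
    unfolding z0_def by (rule m1.kernel_local[OF c x, of t]) blast
  obtain r2 where r2: "r2 > 0" "ball z0 r2 \<subseteq> chart_image c"
    "\<And>z. z \<in> ball z0 r2 \<Longrightarrow> geodesic_dist A g2 x (chart_inv c z) \<noteq> \<infinity>"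
    "continuous_on (ball z0 r2) (\<lambda>z. m2.kernel t x (chart_inv c z))" "m2.kernel t x x = 1"
    unfolding z0_def by (rule m2.kernel_local[OF c x, of t]) blast
  define r where "r = min r1 r2"
  have r: "r > 0" "ball z0 r \<subseteq> ball z0 r1" "ball z0 r \<subseteq> ball z0 r2" using r1 r2 by (auto simp: r_def)
  have rc: "ball z0 r \<subseteq> chart_image c" using r(2) r1(2) by blast
  let ?H1 = "\<lambda>z. m1.kernel t x (chart_inv c z) * p1 (chart_inv c z) * m1.vol_density c z"
  let ?H2 = "\<lambda>z. m2.kernel t x (chart_inv c z) * p2 (chart_inv c z) * m2.vol_density c z"
  have pc: "continuous_on (ball z0 r) (\<lambda>z. p (chart_inv c z))" if "continuous_on UNIV p" for p :: "'a \<Rightarrow> real"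
    by (rule continuous_on_compose2[OF that continuous_on_subset[OF m1.continuous_chart_inv[OF c] rc]]) simp
  have H1: "continuous_on (ball z0 r) ?H1"
    by (intro continuous_on_mult pc[OF p1(1)] continuous_on_subset[OF r1(4) r(2)]
        continuous_on_subset[OF m1.continuous_vol_density[OF c] rc])
  have H2: "continuous_on (ball z0 r) ?H2"
    by (intro continuous_on_mult pc[OF p2(1)] continuous_on_subset[OF r2(4) r(3)]
        continuous_on_subset[OF m2.continuous_vol_density[OF c] rc])
  let ?S = "ball z0 r - {z0}"
  have S: "open ?S" by (intro open_delete open_ball)
  have punctured: "?H1 z = ?H2 z" if "z \<in> ?S" for z
  proof (rule bump_integrals_determine[OF S _ _ _ that])
    show "continuous_on ?S ?H1" "continuous_on ?S ?H2"
      using H1 H2 by (auto intro: continuous_on_subset)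
    fix z1 and \<rho> :: real assume \<rho>: "\<rho> > 0" "cball z1 \<rho> \<subseteq> ?S"
    let ?b = "\<lambda>u. max 0 (\<rho> - dist z1 u)"
    have b: "continuous_on UNIV ?b" by (intro continuous_intros)
    have supp: "?b u = 0" if "u \<notin> cball z1 \<rho>" for u using that by simp
    then have suppV: "?b u = 0" if "u \<notin> ball z0 r" for u using that \<rho>(2) by blast
    have "z0 \<notin> cball z1 \<rho>" using \<rho>(2) by blast
    then have b0: "?b (chart_map c x) = 0" unfolding z0_def[symmetric] by (rule supp)
    have "L_op A t g1 p1 (chart_bump c ?b) x = L_op A t g2 p2 (chart_bump c ?b) x"
    proof (rule fun_cong[OF same])
      have "cball z1 \<rho> \<subseteq> chart_image c" using \<rho>(2) rc by blast
      then show "continuous_on UNIV (chart_bump c ?b)"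
        by (rule m1.continuous_chart_bump[OF c b compact_cball]) (rule supp)
    qed
    moreover have "L_op A t g1 p1 (chart_bump c ?b) x = - (1 / t powr (real CARD('n) / 2 + 1)) * (LINT u|lborel. ?b u * ?H1 u)"
      by (rule m1.L_op_chart_bump[OF compact_UNIV c x p1(1) b open_ball rc suppV b0 continuous_on_subset[OF r1(4) r(2)]])
    moreover have "L_op A t g2 p2 (chart_bump c ?b) x = - (1 / t powr (real CARD('n) / 2 + 1)) * (LINT u|lborel. ?b u * ?H2 u)"
      by (rule m2.L_op_chart_bump[OF compact_UNIV c x p2(1) b open_ball rc suppV b0 continuous_on_subset[OF r2(4) r(3)]])
    moreover have "t powr (real CARD('n) / 2 + 1) \<noteq> 0" using t by simp
    ultimately show "(LINT u|lborel. ?b u * ?H1 u) = (LINT u|lborel. ?b u * ?H2 u)" by simp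
  qed
  have z0r: "z0 \<in> ball z0 r" using r(1) by simp
  have center: "?H1 z0 = ?H2 z0"
  proof (rule tendsto_unique[OF trivial_limit_at])
    have at: "at z0 within ball z0 r = at z0" by (rule at_within_open[OF z0r open_ball])
    show "(?H2 \<longlongrightarrow> ?H2 z0) (at z0)" using H2 z0r unfolding continuous_on_def at[symmetric] by blast
    have "(?H1 \<longlongrightarrow> ?H1 z0) (at z0)" using H1 z0r unfolding continuous_on_def at[symmetric] by blast
    then show "(?H2 \<longlongrightarrow> ?H1 z0) (at z0)"
      by (rule Lim_transform_within_open[OF _ open_ball z0r]) (use punctured in blast)
  qed
  show ?thesis
  proof (rule that[of r, folded z0_def, OF r(1) rc])
    fix z assume z: "z \<in> ball z0 r"
    show "geodesic_dist A g1 x (chart_inv c z) \<noteq> \<infinity> \<and> geodesic_dist A g2 x (chart_inv c z) \<noteq> \<infinity>"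
      using r1(3)[of z] r2(3)[of z] r z by blast
    show "?H1 z = ?H2 z" using punctured[of z] center z by (cases "z = z0") auto
  qed (fact r1(5) r2(5))+
qed

text \<open>
  Evaluate the equality of densities on the diagonal, where both kernels are 1.
\<close>

lemma weighted_volumes_eq:
  assumes c: "c \<in> A" and x: "x \<in> chart_dom c"
  shows "p1 x * sqrt (det (m1.G c x)) = p2 x * sqrt (det (m2.G c x))"
proof -
  obtain r where r: "r > 0"
    "\<And>z. z \<in> ball (chart_map c x) r \<Longrightarrow>
      m1.kernel t x (chart_inv c z) * p1 (chart_inv c z) * m1.vol_density c z =
      m2.kernel t x (chart_inv c z) * p2 (chart_inv c z) * m2.vol_density c z"
    "m1.kernel t x x = 1" "m2.kernel t x x = 1"
    by (rule kernel_densities_eq[OF c x]) blast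
  show ?thesis using r(2)[of "chart_map c x"] r(1,3,4) by (simp add: m1.chart_inv_map[OF c x])
qed

text \<open>
  Dividing the equality of densities by the weighted volumes, which agree at every point,
  leaves the equality of the kernels.
\<close>

lemma geodesic_dist_eq:
  assumes c: "c \<in> A" and x: "x \<in> chart_dom c"
  obtains r where "r > 0"
    "\<And>z. z \<in> ball (chart_map c x) r \<Longrightarrow>
      geodesic_dist A g1 x (chart_inv c z) = geodesic_dist A g2 x (chart_inv c z)"
proof -
  obtain r where r: "r > 0" "ball (chart_map c x) r \<subseteq> chart_image c"
    "\<And>z. z \<in> ball (chart_map c x) r \<Longrightarrow>
      geodesic_dist A g1 x (chart_inv c z) \<noteq> \<infinity> \<and> geodesic_dist A g2 x (chart_inv c z) \<noteq> \<infinity>"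
    "\<And>z. z \<in> ball (chart_map c x) r \<Longrightarrow>
      m1.kernel t x (chart_inv c z) * p1 (chart_inv c z) * m1.vol_density c z =
      m2.kernel t x (chart_inv c z) * p2 (chart_inv c z) * m2.vol_density c z"
    by (rule kernel_densities_eq[OF c x]) blast
  show ?thesis
  proof (rule that[OF r(1)])
    fix z assume z: "z \<in> ball (chart_map c x) r"
    then have dom: "chart_inv c z \<in> chart_dom c" using r(2) by (intro m1.chart_inv_in_dom[OF c]) blast
    have "0 < p1 (chart_inv c z) * m1.vol_density c z"
      using p1(2) m1.det_pos[OF c dom] by simp
    then have "m1.kernel t x (chart_inv c z) = m2.kernel t x (chart_inv c z)"
      using r(4)[OF z] weighted_volumes_eq[OF c dom] by (auto simp: mult.assoc)
    then show "geodesic_dist A g1 x (chart_inv c z) = geodesic_dist A g2 x (chart_inv c z)"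
      using r(3)[OF z] t by (intro gauss_kernel_inject[of t]) auto
  qed
qed

end

section \<open>Recovering the metric and the density\<close>

context same_operator
begin

lemma metric_matrix_eq:
  assumes c: "c \<in> A" and x: "x \<in> chart_dom c"
  shows "m1.G c x = m2.G c x"
proof -
  obtain r where r: "r > 0" "\<And>z. z \<in> ball (chart_map c x) r \<Longrightarrow>
      geodesic_dist A g1 x (chart_inv c z) = geodesic_dist A g2 x (chart_inv c z)"
    by (rule geodesic_dist_eq[OF c x]) blast
  have "form_norm (m1.G c x) w = form_norm (m2.G c x) w" for w
    using form_norm_le_of_geodesic_dist_eq[OF m1.continuous_metric_axioms m2.continuous_metric_axioms c x r, of w]
      form_norm_le_of_geodesic_dist_eq[OF m2.continuous_metric_axioms m1.continuous_metric_axioms c x r(1) r(2)[symmetric], of w]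
    by (rule antisym)
  then show ?thesis
    by (intro symmetric_form_eq m1.metric_matrix_symmetric[OF c x] m2.metric_matrix_symmetric[OF c x])
      (simp add: form_norm_def)
qed

lemma metrics_eq: "metric_eq A g1 g2"
  unfolding metric_eq_def
proof (intro allI ballI)
  fix x u v assume uv: "u \<in> tangent_space A x" "v \<in> tangent_space A x"
  obtain c where c: "c \<in> A" "x \<in> chart_dom c" by (rule m1.chart_around)
  have "g1 x (m1.T c x (u c)) (m1.T c x (v c)) = g2 x (m1.T c x (u c)) (m1.T c x (v c))"
    unfolding m1.metric_coords[OF c] m2.metric_coords[OF c] metric_matrix_eq[OF c] ..
  then show "g1 x u v = g2 x u v"
    unfolding m1.tangent_of_coords_surj[OF c uv(1)] m1.tangent_of_coords_surj[OF c uv(2)] .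
qed

lemma densities_eq: "p1 = p2"
proof
  fix x
  obtain c where c: "c \<in> A" "x \<in> chart_dom c" by (rule m1.chart_around)
  show "p1 x = p2 x"
    using weighted_volumes_eq[OF c] m2.det_pos[OF c] unfolding metric_matrix_eq[OF c] by simp
qed

end

lemma riemannian_metric_continuous:
  assumes "riemannian_metric k A g"
  shows "riemannian_metric 0 A g"
  using assms C_k_on_imp_continuous_on[of k] unfolding riemannian_metric_def C_k_on.simps(1) by blast

theorem theorem2p4:
  fixes A :: "('a::{t2_space, second_countable_topology}, 'n::finite) chart set"
    and g1 g2 :: "('a, 'n) metric_field"
    and p1 p2 :: "'a \<Rightarrow> real"
    and t :: real
  assumes "smooth_atlas A"
    and "compact (UNIV :: 'a set)"
    and "t > 0"
    and "riemannian_metric 2 A g1"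
    and "riemannian_metric 2 A g2"
    and "continuous_on UNIV p1"
    and "continuous_on UNIV p2"
    and "\<forall>x. p1 x > 0"
    and "\<forall>x. p2 x > 0"
    and "\<forall>f. continuous_on UNIV f \<longrightarrow> L_op A t g1 p1 f = L_op A t g2 p2 f"
  shows "metric_eq A g1 g2 \<and> p1 = p2"
proof -
  interpret same_operator A g1 g2 p1 p2 t
    by unfold_locales (use assms riemannian_metric_continuous in blast)+
  show ?thesis using metrics_eq densities_eq by blast
qed

end
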